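(* Suppose $S$ has no eigenvalues with modulus smaller than $1$ and the digraph $\bar{\mathcal G}$ is connected, in the sense that it contains a directed spanning tree with the node $0$ as the root. Let $(G_1,G_2)$ be a minimal $p$-copy internal model of $S$. Then: (i) If a static state feedback control law of the form $$u_i(t)=K_x\eta_i(t)+K_z\bar z_i(t-r_{com}),\quad i=1,\dots,N,$$ stabilizes the nominal plant of the auxiliary augmented system with $v=0$, then the dynamic state feedback control law $$u_i(t)=K_x\eta_i(t)+K_z\bar z_i(t-r_{com}),\qquad \bar z_i(t+1)=G_1\bar z_i(t)+G_2e_{vi}(t),\quad i=1,\dots,N,$$ solves the cooperative robust output regulation problem of the plant and the exosystem. (ii) If a dynamic output feedback control law of the form $$\begin{aligned}u_i(t)&=K_1\bar z_i(t-r_{com})+K_2\bar\eta_i(t-r_{com}),\\ \bar\xi_i(t+1)&=A\bar\xi_i(t)+Bu_i(t-r_{con})-LC\bar\eta_i(t)+Le_{vi}(t),\quad i=1,\dots,N,\end{aligned}$$ stabilizes the nominal plant of the auxiliary augmented system with $v=0$, then the dynamic output feedback control law $$\begin{aligned}u_i(t)&=K_1\bar z_i(t-r_{com})+K_2\bar\eta_i(t-r_{com}),\\ \bar z_i(t+1)&=G_1\bar z_i(t)+G_2e_{vi}(t),\\ \bar\xi_i(t+1)&=A\bar\xi_i(t)+Bu_i(t-r_{con})-LC\bar\eta_i(t)+Le_{vi}(t),\quad i=1,\dots,N,\end{aligned}$$ solves the cooperative robust output regulation problem of the plant and the exosystem.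
   Context: **Plant.** $N$ followers, for $t\in\mathbb{Z}^+=\{0,1,\dots\}$: $$x_i(t+1)=\bar A_ix_i(t)+\bar B_iu_i(t-r_{con})+\bar E_iv(t),\quad y_i(t)=\bar C_ix_i(t),\quad i=1,\dots,N,$$ where $x_i(t)\in\mathbb{R}^n$, $u_i(t)\in\mathbb{R}^m$, $y_i(t)\in\mathbb{R}^p$, and $r_{con}\in\mathbb{Z}^+$ is the input delay. Here $\bar A_i=A+\delta_iA$, $\bar B_i=B+\delta_iB$, $\bar E_i=E+\delta_iE$, $\bar C_i=C+\delta_iC$, where $A,B,E,C$ are the nominal matrices and $\delta_iA,\delta_iB,\delta_iE,\delta_iC$ are the uncertain parts. The vector $w$ collects all entries of all the uncertain parts; the nominal system is the one with $w=0$. **Exosystem (leader).** $v(t+1)=Sv(t)$, with $v(t)\in\mathbb{R}^q$ and $S\in\mathbb{R}^{q\times q}$. The leader output is $y_0(t)=-Fv(t)$ with $F\in\mathbb{R}^{p\times q}$, and the regulated outputs are $e_i(t)=y_i(t)-y_0(t)$, $i=1,\dots,N$. **Graph.** $\bar{\mathcal G}=(\bar{\mathcal V},\bar{\mathcal E})$ is a digraph with node set $\bar{\mathcal V}=\{0,1,\dots,N\}$, where node $0$ is the leader and node $i$ is the $i$-th follower. It has weighted adjacency matrix $[a_{ij}]_{i,j=0}^N$ with $a_{ii}=0$, $a_{ij}>0\Leftrightarrow(j,i)\in\bar{\mathcal E}$, and $a_{ij}=a_{ji}$ if the edge $(i,j)$ is undirected (i.e. both $(i,j),(j,i)\in\bar{\mathcal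 E}$). The neighbor set of $i$ is $\bar{\mathcal N}_i=\{j:(j,i)\in\bar{\mathcal E}\}$. **Signals in the control laws.** $r_{com}\in\mathbb{Z}^+$ is the communication delay; $K_x,K_z,K_1,K_2,L$ are constant real matrices of appropriate dimensions; $\bar\xi_i(t)\in\mathbb{R}^n$ for $i=1,\dots,N$, and $\bar\xi_0(t):=0$, $x_0(t):=0$. Set $$e_{vi}(t)=\sum_{j\in\bar{\mathcal N}_i}a_{ij}(y_i(t)-y_j(t)),\quad \eta_i(t)=\sum_{j\in\bar{\mathcal N}_i}a_{ij}\big(x_i(t-r_{com})-x_j(t-r_{com})\big),\quad \bar\eta_i(t)=\sum_{j\in\bar{\mathcal N}_i}a_{ij}\big(\bar\xi_i(t)-\bar\xi_j(t)\big).$$ **Internal model.** $(G_1,G_2)$ is a minimal $p$-copy internal model of $S$ if $G_1=I_p\otimes\beta$ and $G_2=I_p\otimes\sigma$, where $\beta$ is a constant square matrix whose characteristic polynomial equals the minimal polynomial of $S$, and $\sigma$ is a constant column vector such that $(\beta,\sigma)$ is controllable. $\otimes$ is the Kronecker product. **Auxiliary augmented system.** $$x_i(t+1)=\bar A_ix_i(t)+\bar B_iu_i(t-r_{con})+\bar E_iv(t),\qquad z_i(t+1)=G_1z_i(t)+G_2e_{vi}(t-r_{com}),\quad i=1,\dots,N,$$ where $z_i$ and $\bar z_i$ are related by $z_i(t)=\bar z_i(t-r_{com})$, so that $\bar z_i(t+1)=G_1\bar z_i(t)+G_2e_{vi}(t)$. Its nominal plant is the one with $w=0$. "Stabilizes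 the nominal plant with $v=0$" means that the resulting closed-loop system with $w=0$, $v=0$ is exponentially (equivalently, for these linear time-invariant delay systems, asymptotically) stable. **Problem.** A control law solves the (discrete-time linear) cooperative robust output regulation problem if the closed-loop system satisfies: (Property 1) the nominal closed-loop system ($w=0$) is exponentially stable when $v=0$; (Property 2) there is an open neighborhood $W$ of $w=0$ such that, for every $w\in W$ and all initial conditions of the plant, controller and exosystem, $\lim_{t\to\infty}e_i(t)=0$ for $i=1,\dots,N$. Initial conditions of the delayed closed-loop states are arbitrary functions on $\{-r,\dots,0\}$, with $r=r_{com}+r_{con}$. *)

theory Defs
  imports "HOL-Analysis.Analysis" "HOL-Computational_Algebra.Polynomial"
begin

section \<open>Matrices\<close>

text \<open>The product \<open>*\<close> on \<open>real^'n^'n\<close> is entrywise, so powers are built from \<open>**\<close>.\<close>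

primrec matpow :: "real^'n^'n \<Rightarrow> nat \<Rightarrow> real^'n^'n" where
  "matpow M 0 = mat 1"
| "matpow M (Suc k) = M ** matpow M k"

definition poly_mat :: "real poly \<Rightarrow> real^'n^'n \<Rightarrow> real^'n^'n" where
  "poly_mat f M = (\<Sum>k\<le>degree f. coeff f k *\<^sub>R matpow M k)"

definition is_minimal_poly :: "real poly \<Rightarrow> real^'n^'n \<Rightarrow> bool" where
  "is_minimal_poly f M \<longleftrightarrow>
     lead_coeff f = 1 \<and> poly_mat f M = 0 \<and>
     (\<forall>g. g \<noteq> 0 \<and> poly_mat g M = 0 \<longrightarrow> degree f \<le> degree g)"

definition charac_poly :: "real^'n^'n \<Rightarrow> real poly" where
  "charac_poly M = det (mat [:0, 1:] - map_matrix (\<lambda>c. [:c:]) M)"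

definition is_eigenvalue :: "real^'n^'n \<Rightarrow> complex \<Rightarrow> bool" where
  "is_eigenvalue M \<mu> \<longleftrightarrow>
     (\<exists>x :: complex^'n. x \<noteq> 0 \<and> map_matrix complex_of_real M *v x = \<mu> *s x)"

text \<open>Full row rank of the controllability matrix \<open>[b, M b, \<dots>, M^(k-1) b]\<close>.\<close>

definition controllable :: "real^'k^'k \<Rightarrow> real^'k \<Rightarrow> bool" where
  "controllable M b \<longleftrightarrow> dim {matpow M l *v b | l. l < CARD('k)} = CARD('k)"

text \<open>Kronecker product, the rows and columns being indexed by pairs (block, index in block).\<close>

definition kron :: "real^'b^'a \<Rightarrow> real^'d^'c \<Rightarrow> real^('b \<times> 'd)^('a \<times> 'c)" where
  "kron M M' = (\<chi> r c. M $ fst r $ fst c * M' $ snd r $ snd c)"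

text \<open>Kronecker product with a one-column matrix, whose single column index is dropped.\<close>

definition kron_col :: "real^'b^'a \<Rightarrow> real^'c \<Rightarrow> real^'b^('a \<times> 'c)" where
  "kron_col M b = (\<chi> r j. M $ fst r $ j * b $ snd r)"

definition minimal_p_copy_internal_model ::
  "real^'q^'q \<Rightarrow> real^('p \<times> 'k::finite)^('p \<times> 'k) \<Rightarrow> real^'p^('p \<times> 'k) \<Rightarrow> bool" where
  "minimal_p_copy_internal_model S G1 G2 \<longleftrightarrow>
     (\<exists>(\<beta> :: real^'k^'k) (\<sigma> :: real^'k).
        G1 = kron (mat 1) \<beta> \<and> G2 = kron_col (mat 1) \<sigma> \<and>
        is_minimal_poly (charac_poly \<beta>) S \<and> controllable \<beta> \<sigma>)"


section \<open>Plant, exosystem and digraph\<close>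

text \<open>
  The followers are indexed by a finite type \<open>'f\<close>, and the nodes of the digraph by
  \<open>'f option\<close>, where \<open>None\<close> is the leader (node 0).
\<close>

record ('n, 'm, 'p, 'q, 'f) mas =
  Anom :: "real^'n^'n"
  Bnom :: "real^'m^'n"
  Enom :: "real^'q^'n"
  Cnom :: "real^'n^'p"
  Smat :: "real^'q^'q"
  Fmat :: "real^'q^'p"
  edges :: "('f option \<times> 'f option) set"
  weight :: "'f option \<Rightarrow> 'f option \<Rightarrow> real"
  rcon :: nat
  rcom :: nat

text \<open>
  The vector \<open>w\<close>: its component \<open>w $ i\<close> is the tuple
  \<open>(\<delta>\<^sub>iA, \<delta>\<^sub>iB, \<delta>\<^sub>iE, \<delta>\<^sub>iC)\<close>.
\<close>

type_synonym ('n, 'm, 'p, 'q, 'f) uncertainty =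
  "((real^'n^'n) \<times> (real^'m^'n) \<times> (real^'q^'n) \<times> (real^'n^'p))^'f"

definition Abar ::
  "('n::finite,'m::finite,'p::finite,'q::finite,'f::finite) mas \<Rightarrow>
   ('n,'m,'p,'q,'f) uncertainty \<Rightarrow> 'f \<Rightarrow> real^'n^'n" where
  "Abar P w i = Anom P + (case w $ i of (dA, dB, dE, dC) \<Rightarrow> dA)"

definition Bbar ::
  "('n::finite,'m::finite,'p::finite,'q::finite,'f::finite) mas \<Rightarrow>
   ('n,'m,'p,'q,'f) uncertainty \<Rightarrow> 'f \<Rightarrow> real^'m^'n" where
  "Bbar P w i = Bnom P + (case w $ i of (dA, dB, dE, dC) \<Rightarrow> dB)"

definition Ebar ::
  "('n::finite,'m::finite,'p::finite,'q::finite,'f::finite) mas \<Rightarrow>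
   ('n,'m,'p,'q,'f) uncertainty \<Rightarrow> 'f \<Rightarrow> real^'q^'n" where
  "Ebar P w i = Enom P + (case w $ i of (dA, dB, dE, dC) \<Rightarrow> dE)"

definition Cbar ::
  "('n::finite,'m::finite,'p::finite,'q::finite,'f::finite) mas \<Rightarrow>
   ('n,'m,'p,'q,'f) uncertainty \<Rightarrow> 'f \<Rightarrow> real^'n^'p" where
  "Cbar P w i = Cnom P + (case w $ i of (dA, dB, dE, dC) \<Rightarrow> dC)"

definition weighted_digraph ::
  "('n::finite,'m::finite,'p::finite,'q::finite,'f::finite) mas \<Rightarrow>
   bool" where
  "weighted_digraph P \<longleftrightarrow>
     (\<forall>i. weight P i i = 0) \<and>
     (\<forall>i j. weight P i j > 0 \<longleftrightarrow> (j, i) \<in> edges P) \<and>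
     (\<forall>i j. (i, j) \<in> edges P \<and> (j, i) \<in> edges P \<longrightarrow> weight P i j = weight P j i)"

text \<open>A directed tree with root \<open>r\<close> whose node set is the whole type \<open>'v\<close>.\<close>

definition directed_spanning_tree :: "('v \<times> 'v) set \<Rightarrow> 'v \<Rightarrow> bool" where
  "directed_spanning_tree T r \<longleftrightarrow>
     (\<forall>j. (j, r) \<notin> T) \<and>
     (\<forall>i. i \<noteq> r \<longrightarrow> (\<exists>!j. (j, i) \<in> T)) \<and>
     (\<forall>i. (r, i) \<in> T\<^sup>*)"

definition digraph_connected ::
  "('n::finite,'m::finite,'p::finite,'q::finite,'f::finite) mas \<Rightarrow>
   bool" where
  "digraph_connected P \<longleftrightarrow> (\<exists>T \<subseteq> edges P. directed_spanning_tree T None)"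

definition neighbors ::
  "('n::finite,'m::finite,'p::finite,'q::finite,'f::finite) mas \<Rightarrow>
   'f \<Rightarrow> 'f option set" where
  "neighbors P i = {j. (j, Some i) \<in> edges P}"

definition net_diff ::
  "('n::finite,'m::finite,'p::finite,'q::finite,'f::finite) mas \<Rightarrow>
   ('f option \<Rightarrow> real^'d) \<Rightarrow> 'f \<Rightarrow> real^'d" where
  "net_diff P g i = (\<Sum>j\<in>neighbors P i. weight P (Some i) j *\<^sub>R (g (Some i) - g j))"

text \<open>The convention that the leader's \<open>x\<close> and \<open>\<xi>\<close> are zero.\<close>

definition with_leader_0 :: "(real^'d)^'f \<Rightarrow> 'f option \<Rightarrow> real^'d" where
  "with_leader_0 X j = (case j of None \<Rightarrow> 0 | Some i \<Rightarrow> X $ i)"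


section \<open>Signals and system equations\<close>

text \<open>
  Signals are functions of an integer time. Every system equation is imposed for \<open>t \<ge> 0\<close>; the
  equations then refer to times \<open>\<ge> -(r_com + r_con)\<close> only, and the values of a signal at the
  times \<open>-(r_com + r_con), \<dots>, 0\<close> are its (arbitrary) initial function.
\<close>

definition node_output ::
  "('n::finite,'m::finite,'p::finite,'q::finite,'f::finite) mas \<Rightarrow>
   ('n,'m,'p,'q,'f) uncertainty \<Rightarrow> (int \<Rightarrow> real^'q) \<Rightarrow>
   (int \<Rightarrow> (real^'n)^'f) \<Rightarrow> 'f option \<Rightarrow> int \<Rightarrow> real^'p" where
  "node_output P w v x j t =
     (case j of None \<Rightarrow> - (Fmat P *v v t) | Some i \<Rightarrow> Cbar P w i *v (x t $ i))"

definition regulated_output ::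
  "('n::finite,'m::finite,'p::finite,'q::finite,'f::finite) mas \<Rightarrow>
   ('n,'m,'p,'q,'f) uncertainty \<Rightarrow> (int \<Rightarrow> real^'q) \<Rightarrow>
   (int \<Rightarrow> (real^'n)^'f) \<Rightarrow> 'f \<Rightarrow> int \<Rightarrow> real^'p" where
  "regulated_output P w v x i t = node_output P w v x (Some i) t - node_output P w v x None t"

definition virtual_error ::
  "('n::finite,'m::finite,'p::finite,'q::finite,'f::finite) mas \<Rightarrow>
   ('n,'m,'p,'q,'f) uncertainty \<Rightarrow> (int \<Rightarrow> real^'q) \<Rightarrow>
   (int \<Rightarrow> (real^'n)^'f) \<Rightarrow> 'f \<Rightarrow> int \<Rightarrow> real^'p" where
  "virtual_error P w v x i t = net_diff P (\<lambda>j. node_output P w v x j t) i"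

definition eta ::
  "('n::finite,'m::finite,'p::finite,'q::finite,'f::finite) mas \<Rightarrow>
   (int \<Rightarrow> (real^'n)^'f) \<Rightarrow> 'f \<Rightarrow> int \<Rightarrow> real^'n" where
  "eta P x i t = net_diff P (with_leader_0 (x (t - int (rcom P)))) i"

definition etabar ::
  "('n::finite,'m::finite,'p::finite,'q::finite,'f::finite) mas \<Rightarrow>
   (int \<Rightarrow> (real^'n)^'f) \<Rightarrow> 'f \<Rightarrow> int \<Rightarrow> real^'n" where
  "etabar P \<xi> i t = net_diff P (with_leader_0 (\<xi> t)) i"

definition exosystem ::
  "('n::finite,'m::finite,'p::finite,'q::finite,'f::finite) mas \<Rightarrow>
   (int \<Rightarrow> real^'q) \<Rightarrow> bool" where
  "exosystem P v \<longleftrightarrow> (\<forall>t\<ge>0. v (t + 1) = Smat P *v v t)"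

definition plant_eqs ::
  "('n::finite,'m::finite,'p::finite,'q::finite,'f::finite) mas \<Rightarrow>
   ('n,'m,'p,'q,'f) uncertainty \<Rightarrow> (int \<Rightarrow> real^'q) \<Rightarrow>
   ('f \<Rightarrow> int \<Rightarrow> real^'m) \<Rightarrow> (int \<Rightarrow> (real^'n)^'f) \<Rightarrow> bool" where
  "plant_eqs P w v u x \<longleftrightarrow>
     (\<forall>t\<ge>0. \<forall>i. x (t + 1) $ i =
        Abar P w i *v (x t $ i) + Bbar P w i *v u i (t - int (rcon P)) + Ebar P w i *v v t)"

text \<open>Internal model in its undelayed form (state \<open>zb\<close>) and as it occurs in the auxiliary
  augmented system (state \<open>z\<close>).\<close>

definition zbar_eqs ::
  "('n::finite,'m::finite,'p::finite,'q::finite,'f::finite) mas \<Rightarrow>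
   real^'s^'s \<Rightarrow> real^'p^'s \<Rightarrow> ('n,'m,'p,'q,'f) uncertainty \<Rightarrow>
   (int \<Rightarrow> real^'q) \<Rightarrow> (int \<Rightarrow> (real^'n)^'f) \<Rightarrow> (int \<Rightarrow> (real^'s)^'f) \<Rightarrow> bool" where
  "zbar_eqs P G1 G2 w v x zb \<longleftrightarrow>
     (\<forall>t\<ge>0. \<forall>i. zb (t + 1) $ i = G1 *v (zb t $ i) + G2 *v virtual_error P w v x i t)"

definition aux_z_eqs ::
  "('n::finite,'m::finite,'p::finite,'q::finite,'f::finite) mas \<Rightarrow>
   real^'s^'s \<Rightarrow> real^'p^'s \<Rightarrow> ('n,'m,'p,'q,'f) uncertainty \<Rightarrow>
   (int \<Rightarrow> real^'q) \<Rightarrow> (int \<Rightarrow> (real^'n)^'f) \<Rightarrow> (int \<Rightarrow> (real^'s)^'f) \<Rightarrow> bool" where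
  "aux_z_eqs P G1 G2 w v x z \<longleftrightarrow>
     (\<forall>t\<ge>0. \<forall>i. z (t + 1) $ i =
        G1 *v (z t $ i) + G2 *v virtual_error P w v x i (t - int (rcom P)))"

text \<open>The signal \<open>zb\<close> belonging to \<open>z\<close>, i.e. the one with \<open>z t = zb (t - r_com)\<close>.\<close>

definition zbar_of ::
  "('n::finite,'m::finite,'p::finite,'q::finite,'f::finite) mas \<Rightarrow>
   (int \<Rightarrow> (real^'s)^'f) \<Rightarrow> int \<Rightarrow> (real^'s)^'f" where
  "zbar_of P z t = z (t + int (rcom P))"


section \<open>Control laws and closed-loop systems\<close>

definition state_feedback ::
  "('n::finite,'m::finite,'p::finite,'q::finite,'f::finite) mas \<Rightarrow>
   real^'n^'m \<Rightarrow> real^'s^'m \<Rightarrow>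
   (int \<Rightarrow> (real^'n)^'f) \<Rightarrow> (int \<Rightarrow> (real^'s)^'f) \<Rightarrow> 'f \<Rightarrow> int \<Rightarrow> real^'m" where
  "state_feedback P Kx Kz x zb i t = Kx *v eta P x i t + Kz *v (zb (t - int (rcom P)) $ i)"

definition output_feedback ::
  "('n::finite,'m::finite,'p::finite,'q::finite,'f::finite) mas \<Rightarrow>
   real^'s^'m \<Rightarrow> real^'n^'m \<Rightarrow>
   (int \<Rightarrow> (real^'s)^'f) \<Rightarrow> (int \<Rightarrow> (real^'n)^'f) \<Rightarrow> 'f \<Rightarrow> int \<Rightarrow> real^'m" where
  "output_feedback P K1 K2 zb \<xi> i t =
     K1 *v (zb (t - int (rcom P)) $ i) + K2 *v etabar P \<xi> i (t - int (rcom P))"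

definition observer_eqs ::
  "('n::finite,'m::finite,'p::finite,'q::finite,'f::finite) mas \<Rightarrow>
   real^'p^'n \<Rightarrow> ('n,'m,'p,'q,'f) uncertainty \<Rightarrow> (int \<Rightarrow> real^'q) \<Rightarrow>
   ('f \<Rightarrow> int \<Rightarrow> real^'m) \<Rightarrow> (int \<Rightarrow> (real^'n)^'f) \<Rightarrow> (int \<Rightarrow> (real^'n)^'f) \<Rightarrow> bool" where
  "observer_eqs P L w v u x \<xi> \<longleftrightarrow>
     (\<forall>t\<ge>0. \<forall>i. \<xi> (t + 1) $ i =
        Anom P *v (\<xi> t $ i) + Bnom P *v u i (t - int (rcon P))
        - (L ** Cnom P) *v etabar P \<xi> i t + L *v virtual_error P w v x i t)"

text \<open>
  A closed-loop system is represented by its trajectories: a predicate on the uncertainty \<open>w\<close>,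
  the exogenous signal \<open>v\<close>, the plant state \<open>x\<close> and the trajectory of the remaining states.
\<close>

type_synonym ('n, 'm, 'p, 'q, 'f, 'c) closed_loop =
  "('n,'m,'p,'q,'f) uncertainty \<Rightarrow> (int \<Rightarrow> real^'q) \<Rightarrow> (int \<Rightarrow> (real^'n)^'f) \<Rightarrow> (int \<Rightarrow> 'c) \<Rightarrow> bool"

definition aux_state_feedback_loop ::
  "('n::finite,'m::finite,'p::finite,'q::finite,'f::finite) mas \<Rightarrow>
   real^'s^'s \<Rightarrow> real^'p^'s \<Rightarrow> real^'n^'m \<Rightarrow> real^'s^'m \<Rightarrow>
   ('n,'m,'p,'q,'f, (real^'s)^'f) closed_loop" where
  "aux_state_feedback_loop P G1 G2 Kx Kz w v x z \<longleftrightarrow>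
     plant_eqs P w v (state_feedback P Kx Kz x (zbar_of P z)) x \<and>
     aux_z_eqs P G1 G2 w v x z"

definition state_feedback_loop ::
  "('n::finite,'m::finite,'p::finite,'q::finite,'f::finite) mas \<Rightarrow>
   real^'s^'s \<Rightarrow> real^'p^'s \<Rightarrow> real^'n^'m \<Rightarrow> real^'s^'m \<Rightarrow>
   ('n,'m,'p,'q,'f, (real^'s)^'f) closed_loop" where
  "state_feedback_loop P G1 G2 Kx Kz w v x zb \<longleftrightarrow>
     plant_eqs P w v (state_feedback P Kx Kz x zb) x \<and>
     zbar_eqs P G1 G2 w v x zb"

definition aux_output_feedback_loop ::
  "('n::finite,'m::finite,'p::finite,'q::finite,'f::finite) mas \<Rightarrow>
   real^'s^'s \<Rightarrow> real^'p^'s \<Rightarrow> real^'s^'m \<Rightarrow> real^'n^'m \<Rightarrow> real^'p^'n \<Rightarrow>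
   ('n,'m,'p,'q,'f, ((real^'s)^'f) \<times> ((real^'n)^'f)) closed_loop" where
  "aux_output_feedback_loop P G1 G2 K1 K2 L w v x c \<longleftrightarrow>
     (let z = (\<lambda>t. fst (c t)); \<xi> = (\<lambda>t. snd (c t));
          u = output_feedback P K1 K2 (zbar_of P z) \<xi>
      in plant_eqs P w v u x \<and> aux_z_eqs P G1 G2 w v x z \<and> observer_eqs P L w v u x \<xi>)"

definition output_feedback_loop ::
  "('n::finite,'m::finite,'p::finite,'q::finite,'f::finite) mas \<Rightarrow>
   real^'s^'s \<Rightarrow> real^'p^'s \<Rightarrow> real^'s^'m \<Rightarrow> real^'n^'m \<Rightarrow> real^'p^'n \<Rightarrow>
   ('n,'m,'p,'q,'f, ((real^'s)^'f) \<times> ((real^'n)^'f)) closed_loop" where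
  "output_feedback_loop P G1 G2 K1 K2 L w v x c \<longleftrightarrow>
     (let zb = (\<lambda>t. fst (c t)); \<xi> = (\<lambda>t. snd (c t));
          u = output_feedback P K1 K2 zb \<xi>
      in plant_eqs P w v u x \<and> zbar_eqs P G1 G2 w v x zb \<and> observer_eqs P L w v u x \<xi>)"


section \<open>Stability and the regulation problem\<close>

text \<open>Exponential stability of the delay system (of maximal delay \<open>r\<close>) with the given
  trajectories: decay relative to the sup norm of the initial function.\<close>

definition exp_stable :: "nat \<Rightarrow> (int \<Rightarrow> 'a::real_normed_vector) set \<Rightarrow> bool" where
  "exp_stable r traj \<longleftrightarrow>
     (\<exists>c>0. \<exists>\<rho>. 0 < \<rho> \<and> \<rho> < 1 \<and>
        (\<forall>s\<in>traj. \<forall>t::nat. norm (s (int t)) \<le> c * \<rho> ^ t * (MAX \<theta>\<in>{- int r..0}. norm (s \<theta>))))"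

definition nominal_exp_stable ::
  "('n::finite,'m::finite,'p::finite,'q::finite,'f::finite) mas \<Rightarrow>
   ('n,'m,'p,'q,'f,'c::real_normed_vector) closed_loop \<Rightarrow> bool" where
  "nominal_exp_stable P CL \<longleftrightarrow>
     exp_stable (rcom P + rcon P) {\<lambda>t. (x t, c t) | x c. CL 0 (\<lambda>_. 0) x c}"

definition solves_coop_robust_output_regulation ::
  "('n::finite,'m::finite,'p::finite,'q::finite,'f::finite) mas \<Rightarrow>
   ('n,'m,'p,'q,'f,'c::real_normed_vector) closed_loop \<Rightarrow> bool" where
  "solves_coop_robust_output_regulation P CL \<longleftrightarrow>
     nominal_exp_stable P CL \<and>
     (\<exists>W. open W \<and> 0 \<in> W \<and>
        (\<forall>w\<in>W. \<forall>v x c. exosystem P v \<and> CL w v x c \<longrightarrow>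
           (\<forall>i. (\<lambda>t::nat. regulated_output P w v x i (int t)) \<longlonglongrightarrow> 0)))"

end

theory Submission
  imports Defs
begin

text \<open>
  The argument works with whole trajectories.

  Stability. Advancing the plant and observer states of a trajectory of the closed loop by \<open>rcom\<close>
  steps, and leaving the internal model state as it is, gives a trajectory of the auxiliary
  augmented system. Exponential decay of the latter therefore implies that of the former
  (\<open>nominal_exp_stable_of_auxiliary\<close>). Moreover, a perturbation of the uncertain matrices that is
  small enough leaves all unforced trajectories convergent to 0, since over a long fixed horizon
  the closed loop remains a contraction (\<open>exp_stable_robust\<close>).

  Regulation. Let \<open>f\<close> be the characteristic polynomial of \<open>\<beta>\<close>, which is the minimal polynomial of
  \<open>S\<close>, and apply \<open>f\<close> of the forward shift to a whole trajectory driven by the exosystem. Since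
  \<open>f(S) = 0\<close>, the result is a trajectory with \<open>v = 0\<close> (\<open>filtered_trajectory_unforced\<close>), so it tends
  to 0, and in particular the filtered internal model state does. By the Cayley-Hamilton
  theorem \<open>f(\<beta>) = 0\<close>, so that filtered state is a combination of the vectors \<open>\<beta>\<^sup>l \<sigma>\<close> with
  coefficients formed from the virtual errors at the times \<open>t, \<dots>, t + d - 1\<close>, where \<open>d\<close> is the
  degree of \<open>f\<close>. Only the virtual error at time \<open>t\<close> comes with \<open>\<beta>\<close> to the power \<open>d - 1\<close>, and by
  controllability a linear functional isolates it (\<open>internal_model_recovers_input\<close>). Hence the
  virtual errors tend to 0, whatever the growth of \<open>v\<close>.

  Network. The virtual errors are the image of the regulated outputs under the grounded Laplacian,
  which is injective by the maximum principle because the leader reaches every follower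
  (\<open>net_diff_with_leader_0_inj\<close>). Hence the regulated outputs tend to 0 as well.
\<close>

section \<open>The Cayley-Hamilton theorem and controllable pairs\<close>

definition adjugate :: "'a::comm_ring_1^'n^'n \<Rightarrow> 'a^'n^'n" where
  "adjugate A = (\<chi> j l. det (\<chi> r. if r = l then axis j 1 else row r A))"

text \<open>
  By linearity of the determinant in one row, the \<open>(i, l)\<close> entry of the product is the determinant
  of \<open>A\<close> with row \<open>l\<close> replaced by row \<open>i\<close>; for \<open>i \<noteq> l\<close> this matrix has two equal rows.
\<close>

lemma mult_adjugate:
  fixes A :: "'a::comm_ring_1^'n^'n"
  shows "A ** adjugate A = mat (det A)"
proof -
  have "(\<Sum>j\<in>UNIV. A $ i $ j * adjugate A $ j $ l) = (if i = l then det A else 0)" for i l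
  proof -
    have row_expansion: "row i A = (\<Sum>j\<in>UNIV. A $ i $ j *s axis j 1)"
      by (simp add: vec_eq_iff row_def axis_def if_distrib cong: if_cong)
    have "(\<Sum>j\<in>UNIV. A $ i $ j * adjugate A $ j $ l)
        = (\<Sum>j\<in>UNIV. det (\<chi> r. if r = l then A $ i $ j *s axis j 1 else row r A))"
      by (simp add: adjugate_def det_row_mul)
    also have "\<dots> = det (\<chi> r. if r = l then row i A else row r A)"
      unfolding row_expansion by (rule det_linear_row_sum[symmetric]) simp
    also have "\<dots> = (if i = l then det A else 0)"
    proof (cases "i = l")
      case True
      then have "(\<chi> r. if r = l then row i A else row r A) = A"
        by (simp add: vec_eq_iff row_def)
      then show ?thesis using True by simp
    next
      case False
      then show ?thesis
        by (simp add: det_identical_rows[OF False] row_def)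
    qed
    finally show ?thesis .
  qed
  then show ?thesis
    by (simp add: vec_eq_iff matrix_matrix_mult_def mat_def)
qed

lemma matpow_commute: "matpow M k ** M = M ** matpow M k"
  by (induction k) (simp_all add: matrix_mul_assoc [symmetric])

lemma degree_charac_poly_le:
  fixes M :: "real^'n^'n"
  shows "degree (charac_poly M) \<le> CARD('n)"
proof -
  let ?A = "mat [:0, 1:] - map_matrix (\<lambda>c. [:c:]) M"
  have entry: "degree (?A $ i $ j) \<le> 1" for i j
    by (simp add: mat_def map_matrix_def)
  have "degree (of_int (sign p) * (\<Prod>i\<in>UNIV. ?A $ i $ p i)) \<le> CARD('n)" for p :: "'n \<Rightarrow> 'n"
  proof -
    have "degree (\<Prod>i\<in>UNIV. ?A $ i $ p i) \<le> (\<Sum>i\<in>UNIV. degree (?A $ i $ p i))"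
      using degree_prod_sum_le[of UNIV "\<lambda>i. ?A $ i $ p i"] by (simp add: o_def)
    also have "\<dots> \<le> (\<Sum>i\<in>(UNIV::'n set). 1)"
      by (intro sum_mono entry)
    finally have "degree (\<Prod>i\<in>UNIV. ?A $ i $ p i) \<le> CARD('n)" by simp
    then show ?thesis
      by (cases p rule: sign_cases) simp_all
  qed
  then show ?thesis
    unfolding charac_poly_def det_def by (intro degree_sum_le) auto
qed

text \<open>
  The adjugate of \<open>X I - M\<close> is a polynomial in \<open>X\<close> with matrix coefficients \<open>B k\<close>. Comparing
  coefficients in \<open>(X I - M) adj (X I - M) = f I\<close> gives \<open>f\<^sub>k I = B (k - 1) - M B k\<close>. Multiplying by
  \<open>M\<^sup>k\<close> and summing, the right-hand sides telescope.
\<close>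

theorem cayley_hamilton:
  fixes M :: "real^'n^'n"
  shows "poly_mat (charac_poly M) M = 0"
proof -
  define f where "f = charac_poly M"
  define Q where "Q = adjugate (mat [:0, 1:] - map_matrix (\<lambda>c. [:c:]) M)"
  define B :: "nat \<Rightarrow> real^'n^'n" where "B k = (\<chi> i j. coeff (Q $ i $ j) k)" for k
  \<comment> \<open>\<open>B'\<close> holds the coefficients of \<open>X adj (X I - M)\<close>.\<close>
  define B' :: "nat \<Rightarrow> real^'n^'n" where "B' k = (case k of 0 \<Rightarrow> 0 | Suc l \<Rightarrow> B l)" for k
  have "mat [:0, 1:] ** Q - map_matrix (\<lambda>c. [:c:]) M ** Q = mat f"
  proof -
    have "mat [:0, 1:] ** Q - map_matrix (\<lambda>c. [:c:]) M ** Q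
        = (mat [:0, 1:] - map_matrix (\<lambda>c. [:c:]) M) ** Q"
      by (simp add: vec_eq_iff matrix_matrix_mult_def left_diff_distrib sum_subtractf)
    then show ?thesis
      unfolding Q_def f_def charac_poly_def by (simp only: mult_adjugate)
  qed
  then have entry: "pCons 0 (Q $ i $ j) - (\<Sum>l\<in>UNIV. smult (M $ i $ l) (Q $ l $ j))
      = (if i = j then f else 0)" for i j
    by (simp add: vec_eq_iff matrix_matrix_mult_def mat_def map_matrix_def
        if_distrib if_distribR cong: if_cong)
  have coefficients: "coeff f k *\<^sub>R mat 1 = B' k - M ** B k" for k
  proof -
    have "B' k $ i $ j - (\<Sum>l\<in>UNIV. M $ i $ l * B k $ l $ j) = (if i = j then coeff f k else 0)" for i j
      using arg_cong[OF entry[of i j], of "\<lambda>q. coeff q k"]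
      by (simp add: B_def B'_def coeff_sum coeff_pCons split: nat.splits if_splits)
    then show ?thesis
      by (simp add: vec_eq_iff matrix_matrix_mult_def mat_def)
  qed
  have step: "coeff f k *\<^sub>R matpow M k = matpow M k ** B' k - matpow M (Suc k) ** B k" for k
  proof -
    have "coeff f k *\<^sub>R matpow M k = matpow M k ** (coeff f k *\<^sub>R mat 1)"
      by (simp add: vec_eq_iff matrix_matrix_mult_def mat_def if_distrib cong: if_cong)
    also have "\<dots> = matpow M k ** B' k - matpow M k ** (M ** B k)"
      unfolding coefficients
      by (simp add: vec_eq_iff matrix_matrix_mult_def right_diff_distrib sum_subtractf)
    finally show ?thesis
      by (simp add: matrix_mul_assoc matpow_commute)
  qed
  define n where "n = degree f + (\<Sum>i\<in>UNIV. \<Sum>j\<in>UNIV. Suc (degree (Q $ i $ j)))"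
  have "B n = 0"
  proof -
    have "degree (Q $ i $ j) < n" for i j
    proof -
      have "Suc (degree (Q $ i $ j)) \<le> (\<Sum>j\<in>UNIV. Suc (degree (Q $ i $ j)))"
        by (rule member_le_sum) auto
      also have "\<dots> \<le> (\<Sum>i\<in>UNIV. \<Sum>j\<in>UNIV. Suc (degree (Q $ i $ j)))"
        by (rule member_le_sum) auto
      finally show ?thesis unfolding n_def by linarith
    qed
    then show ?thesis by (simp add: vec_eq_iff B_def coeff_eq_0)
  qed
  have partial: "(\<Sum>k\<le>m. coeff f k *\<^sub>R matpow M k) = - (matpow M (Suc m) ** B m)" for m
  proof (induction m)
    case 0
    then show ?case using step[of 0] by (simp add: B'_def)
  next
    case (Suc m)
    then show ?case using step[of "Suc m"] by (simp add: B'_def del: matpow.simps)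
  qed
  have "poly_mat f M = (\<Sum>k\<le>n. coeff f k *\<^sub>R matpow M k)"
    unfolding poly_mat_def
    by (rule sum.mono_neutral_left) (auto simp: n_def coeff_eq_0)
  also have "\<dots> = 0"
    unfolding partial \<open>B n = 0\<close> by simp
  finally show ?thesis unfolding f_def .
qed

text \<open>
  The \<open>CARD('k)\<close> columns of the controllability matrix span a space of dimension \<open>CARD('k)\<close>, so they
  are a basis, and linear functionals may be prescribed on them. The functional obtained here
  later reads the driving input off the state of an internal model.
\<close>

lemma controllable_dual_functional:
  fixes M :: "real^'k^'k" and b :: "real^'k"
  assumes "controllable M b" and "m < CARD('k)"
  shows "\<exists>g. linear g \<and> (\<forall>l\<le>m. g (matpow M l *v b) = (if l = m then 1 else 0 :: real))"
proof -
  let ?v = "\<lambda>l. matpow M l *v b" and ?I = "{..<CARD('k)}"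
  have "{matpow M l *v b | l. l < CARD('k)} = ?v ` ?I" by auto
  with assms(1) have dim: "dim (?v ` ?I) = CARD('k)"
    by (simp add: controllable_def)
  have "card (?v ` ?I) \<le> CARD('k)" using card_image_le[of ?I ?v] by simp
  moreover have "dim (?v ` ?I) \<le> card (?v ` ?I)" by (simp add: dim_le_card')
  ultimately have card: "card (?v ` ?I) = CARD('k)" using dim by simp
  then have inj: "inj_on ?v ?I" by (simp add: eq_card_imp_inj_on)
  have "independent (?v ` ?I)"
    using card dim by (intro card_le_dim_spanning[of _ "?v ` ?I"] ) (auto simp: span_superset)
  then obtain g where "linear g" and g: "\<And>x. x \<in> ?v ` ?I \<Longrightarrow> g x = (if x = ?v m then 1 else 0 :: real)"
    using linear_independent_extend[of "?v ` ?I" "\<lambda>x. if x = ?v m then 1 else 0 :: real"] by blast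
  have "g (?v l) = (if l = m then 1 else 0)" if "l \<le> m" for l
  proof -
    have "l \<in> ?I" "m \<in> ?I" using that assms(2) by auto
    then have "?v l = ?v m \<longleftrightarrow> l = m" using inj by (auto dest: inj_onD)
    then show ?thesis using g[of "?v l"] \<open>l \<in> ?I\<close> by auto
  qed
  with \<open>linear g\<close> show ?thesis by blast
qed

section \<open>Linear recurrences with one delay\<close>

definition delay_trajectory :: "nat \<Rightarrow> ('a \<times> 'a \<Rightarrow> 'a) \<Rightarrow> (int \<Rightarrow> 'a) \<Rightarrow> bool" where
  "delay_trajectory r \<Phi> s \<longleftrightarrow> (\<forall>t\<ge>0. s (t + 1) = \<Phi> (s t, s (t - int r)))"

lemma delay_trajectory_shift:
  assumes "delay_trajectory r \<Phi> s"
  shows "delay_trajectory r \<Phi> (\<lambda>t. s (t + int T))"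
  unfolding delay_trajectory_def
proof (intro allI impI)
  fix t :: int assume "t \<ge> 0"
  then have "t + int T \<ge> 0" by simp
  then have "s (t + int T + 1) = \<Phi> (s (t + int T), s (t + int T - int r))"
    using assms by (simp add: delay_trajectory_def)
  then show "s (t + 1 + int T) = \<Phi> (s (t + int T), s (t - int r + int T))"
    by (simp add: algebra_simps)
qed

text \<open>
  Trajectories may be prolonged from any initial function. Here this supplies, for a trajectory
  of a perturbed recurrence, the nominal trajectory with which it is compared.
\<close>

lemma delay_trajectory_exists:
  "\<exists>s. delay_trajectory r \<Phi> s \<and> (\<forall>t\<le>0. s t = h t)"
proof -
  \<comment> \<open>\<open>H n\<close> is the history \<open>h\<close> overwritten with the values of the trajectory at \<open>1, \<dots>, n\<close>.\<close>
  define H where "H = rec_nat h (\<lambda>n g. g(int n + 1 := \<Phi> (g (int n), g (int n - int r))))"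
  have H: "H 0 = h" "H (Suc n) = (H n)(int n + 1 := \<Phi> (H n (int n), H n (int n - int r)))" for n
    by (simp_all add: H_def)
  have mono: "H (n + k) t = H n t" if "t \<le> int n" for n k t
    using that by (induction k) (auto simp: H)
  have final: "H n t = H (nat t) t" if "t \<le> int n" for n t
    using mono[of t "nat t" "n - nat t"] that by (cases "t \<ge> 0") (auto dest: mono[of t 0 n, simplified])
  define s where "s t = H (nat t) t" for t
  have "s (t + 1) = \<Phi> (s t, s (t - int r))" if "t \<ge> 0" for t
  proof -
    obtain n where n: "t = int n" using \<open>t \<ge> 0\<close> by (metis nonneg_int_cases)
    have "s (t + 1) = H (Suc n) (int n + 1)" by (simp add: s_def n nat_add_distrib)
    also have "\<dots> = \<Phi> (H n (int n), H n (int n - int r))" by (simp add: H)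
    also have "\<dots> = \<Phi> (s t, s (t - int r))" using final[of "int n - int r" n] by (simp add: s_def n)
    finally show ?thesis .
  qed
  then show ?thesis by (intro exI[of _ s]) (simp add: delay_trajectory_def s_def H)
qed

text \<open>
  A bound valid on any finite horizon, stable or not: each step multiplies the maximum so far by
  at most \<open>2 K\<close>.
\<close>

lemma delay_growth:
  fixes s :: "int \<Rightarrow> 'a::real_normed_vector"
  assumes step: "\<And>t. t \<ge> 0 \<Longrightarrow> norm (s (t + 1)) \<le> K * (norm (s t) + norm (s (t - int r)))"
    and K: "K \<ge> 1"
    and init: "\<And>t. - int r \<le> t \<Longrightarrow> t \<le> 0 \<Longrightarrow> norm (s t) \<le> M"
    and t: "- int r \<le> t" "t \<le> int n"
  shows "norm (s t) \<le> (2 * K) ^ n * M"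
  using t
proof (induction n arbitrary: t)
  case 0
  then show ?case using init by simp
next
  case (Suc n)
  have "0 \<le> norm (s 0)" by simp
  also have "\<dots> \<le> M" by (rule init) simp_all
  finally have M: "0 \<le> M" .
  show ?case
  proof (cases "t \<le> int n")
    case True
    then have "norm (s t) \<le> (2 * K) ^ n * M" using Suc by simp
    also have "\<dots> \<le> (2 * K) ^ Suc n * M"
      using K M by (intro mult_right_mono power_increasing) auto
    finally show ?thesis .
  next
    case False
    then have t: "t = int n + 1" using Suc.prems by simp
    have "norm (s t) \<le> K * (norm (s (int n)) + norm (s (int n - int r)))"
      unfolding t by (rule step) simp
    also have "\<dots> \<le> K * ((2 * K) ^ n * M + (2 * K) ^ n * M)"
      using K by (intro mult_left_mono add_mono Suc.IH) auto
    finally show ?thesis by (simp add: mult_ac)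
  qed
qed

lemma norm_le_window_max:
  "\<theta> \<in> {- int r..0} \<Longrightarrow> norm (s \<theta>) \<le> (MAX \<theta>\<in>{- int r..0}. norm (s \<theta>))"
  by (rule Max_ge) auto

text \<open>
  Replacing the maximum over the initial window by an arbitrary upper bound \<open>M\<close> frees later
  estimates from computing that maximum.
\<close>

lemma exp_stable_iff:
  "exp_stable r traj \<longleftrightarrow>
     (\<exists>c>0. \<exists>\<rho>. 0 < \<rho> \<and> \<rho> < 1 \<and>
        (\<forall>s\<in>traj. \<forall>M. (\<forall>\<theta>\<in>{- int r..0}. norm (s \<theta>) \<le> M) \<longrightarrow>
            (\<forall>t::nat. norm (s (int t)) \<le> c * \<rho> ^ t * M)))"
    (is "?L \<longleftrightarrow> ?R")
proof
  assume ?L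
  then obtain c \<rho> where c: "c > 0" "0 < \<rho>" "\<rho> < 1"
    and le: "\<And>s t. s \<in> traj \<Longrightarrow> norm (s (int t)) \<le> c * \<rho> ^ t * (MAX \<theta>\<in>{- int r..0}. norm (s \<theta>))"
    unfolding exp_stable_def by blast
  have "norm (s (int t)) \<le> c * \<rho> ^ t * M"
    if "s \<in> traj" "\<forall>\<theta>\<in>{- int r..0}. norm (s \<theta>) \<le> M" for s M t
  proof -
    have "(MAX \<theta>\<in>{- int r..0}. norm (s \<theta>)) \<le> M"
      using that(2) by (intro Max.boundedI) auto
    then have "c * \<rho> ^ t * (MAX \<theta>\<in>{- int r..0}. norm (s \<theta>)) \<le> c * \<rho> ^ t * M"
      using c by (intro mult_left_mono) auto
    then show ?thesis using le[OF that(1), of t] by linarith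
  qed
  with c show ?R by blast
next
  assume ?R
  then obtain c \<rho> where c: "c > 0" "0 < \<rho>" "\<rho> < 1"
    and le: "\<And>s t M. s \<in> traj \<Longrightarrow> \<forall>\<theta>\<in>{- int r..0}. norm (s \<theta>) \<le> M \<Longrightarrow> norm (s (int t)) \<le> c * \<rho> ^ t * M"
    by blast
  have "norm (s (int t)) \<le> c * \<rho> ^ t * (MAX \<theta>\<in>{- int r..0}. norm (s \<theta>))" if "s \<in> traj" for s t
    by (rule le[OF that]) (simp add: norm_le_window_max)
  with c show ?L unfolding exp_stable_def by blast
qed

text \<open>
  Stability passes between two families of trajectories whose members dominate each other up to
  an advance by \<open>m\<close> steps. The advance is harmless: it costs a factor \<open>1 / \<rho> ^ m\<close> in the decay
  constant, and during the first \<open>m\<close> steps the growth bound applies.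
\<close>

lemma exp_stable_transfer:
  fixes N :: "(int \<Rightarrow> 'a::real_normed_vector) set" and N' :: "(int \<Rightarrow> 'b::real_normed_vector) set"
  assumes stable: "exp_stable r N'"
    and K: "K \<ge> 1"
    and growth: "\<And>s t. s \<in> N \<Longrightarrow> t \<ge> 0 \<Longrightarrow> norm (s (t + 1)) \<le> K * (norm (s t) + norm (s (t - int r)))"
    and transfer: "\<And>s. s \<in> N \<Longrightarrow> \<exists>s'\<in>N'. \<forall>t. norm (s' t) \<le> 2 * (norm (s (t + int m)) + norm (s t)) \<and>
        norm (s (t + int m)) \<le> 2 * (norm (s' t) + norm (s' (t + int m)))"
  shows "exp_stable r N"
proof -
  obtain c \<rho> where c: "c > 0" and \<rho>: "0 < \<rho>" "\<rho> < 1"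
    and le: "\<And>s t M. s \<in> N' \<Longrightarrow> \<forall>\<theta>\<in>{- int r..0}. norm (s \<theta>) \<le> M \<Longrightarrow> norm (s (int t)) \<le> c * \<rho> ^ t * M"
    using stable unfolding exp_stable_iff by blast
  define D where "D = (2 * K) ^ m"
  \<comment> \<open>Four factors 2, two in each of the mutual bounds, give 16; the summand 1 covers the first \<open>m\<close>
    steps.\<close>
  define c' where "c' = (16 * c + 1) * D / \<rho> ^ m"
  have D: "D > 0" using K by (simp add: D_def)
  have "norm (s (int n)) \<le> c' * \<rho> ^ n * M"
    if s: "s \<in> N" and init: "\<forall>\<theta>\<in>{- int r..0}. norm (s \<theta>) \<le> M" for s M n
  proof -
    have early: "norm (s t) \<le> D * M" if "- int r \<le> t" "t \<le> int m" for t
      unfolding D_def using that init by (intro delay_growth[OF growth[OF s] K]) auto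
    have "0 \<le> norm (s 0)" by simp
    also have "\<dots> \<le> M" using init by simp
    finally have M: "0 \<le> M" .
    obtain s' where s': "s' \<in> N'"
      and up: "\<And>t. norm (s' t) \<le> 2 * (norm (s (t + int m)) + norm (s t))"
      and down: "\<And>t. norm (s (t + int m)) \<le> 2 * (norm (s' t) + norm (s' (t + int m)))"
      using transfer[OF s] by blast
    have "\<forall>\<theta>\<in>{- int r..0}. norm (s' \<theta>) \<le> 4 * D * M"
    proof
      fix \<theta> assume \<theta>: "\<theta> \<in> {- int r..0}"
      have "norm (s' \<theta>) \<le> 2 * (D * M + D * M)"
        using \<theta> by (intro order_trans[OF up] mult_left_mono add_mono early) auto
      then show "norm (s' \<theta>) \<le> 4 * D * M" by simp
    qed
    note decay = le[OF s' this]
    show ?thesis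
    proof (cases "n < m")
      case True
      have "norm (s (int n)) \<le> D * M" using True by (intro early) auto
      also have "\<dots> = 1 * 1 * (D * M)" by simp
      also have "\<dots> \<le> (16 * c + 1) * (\<rho> ^ n / \<rho> ^ m) * (D * M)"
      proof (intro mult_right_mono mult_mono)
        have "\<rho> ^ m \<le> \<rho> ^ n" using True \<rho> by (intro power_decreasing) auto
        then show "1 \<le> \<rho> ^ n / \<rho> ^ m" using \<rho> by simp
      qed (use c D M in auto)
      finally show ?thesis by (simp add: c'_def mult_ac)
    next
      case False
      define k where "k = n - m"
      have n: "n = k + m" using False by (simp add: k_def)
      have "norm (s (int n)) \<le> 2 * (norm (s' (int k)) + norm (s' (int (k + m))))"
        using down[of "int k"] by (simp add: n)
      also have "\<dots> \<le> 2 * (c * \<rho> ^ k * (4 * D * M) + c * \<rho> ^ (k + m) * (4 * D * M))"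
        by (intro mult_left_mono add_mono decay) auto
      also have "\<dots> \<le> 2 * (c * \<rho> ^ k * (4 * D * M) + c * \<rho> ^ k * (4 * D * M))"
        using c \<rho> D M by (intro mult_left_mono add_mono mult_right_mono power_decreasing) auto
      also have "\<dots> = 16 * c * (\<rho> ^ k * D * M)" by simp
      also have "\<dots> \<le> (16 * c + 1) * (\<rho> ^ k * D * M)"
        using \<rho> D M by (intro mult_right_mono) auto
      also have "\<dots> = c' * \<rho> ^ n * M" using \<rho> by (simp add: c'_def n power_add)
      finally show ?thesis .
    qed
  qed
  moreover have "c' > 0" using c D \<rho> by (simp add: c'_def add_pos_pos)
  ultimately show ?thesis unfolding exp_stable_iff using \<rho> by blast
qed

text \<open>
  Exponential stability survives small perturbations of the step map, with attraction in place of
  an explicit rate. On a horizon of \<open>T\<close> steps the nominal trajectory with the same initial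
  function shrinks to a quarter at the end of the window, while the perturbed trajectory departs
  from it by at most another quarter, provided \<open>\<epsilon>\<close> is small compared with \<open>1 / D ^ T\<close>, where
  \<open>D ^ T\<close> bounds the growth on that horizon. Hence the maximum over a window of length \<open>r\<close> is
  halved every \<open>T\<close> steps.
\<close>

lemma exp_stable_robust:
  fixes \<Phi> :: "'a::euclidean_space \<times> 'a \<Rightarrow> 'a"
  assumes lin: "linear \<Phi>"
    and stable: "exp_stable r {s. delay_trajectory r \<Phi> s}"
  shows "\<exists>\<epsilon>>0. \<forall>\<Psi> s. (\<forall>y. norm (\<Psi> y - \<Phi> y) \<le> \<epsilon> * norm y) \<longrightarrow> delay_trajectory r \<Psi> s \<longrightarrow>
           (\<lambda>t. s (int t)) \<longlonglongrightarrow> 0"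
proof -
  obtain K0 where K0: "\<And>y. norm (\<Phi> y) \<le> K0 * norm y"
    using linear_bounded[OF lin] by blast
  obtain c \<rho> where c: "c > 0" and \<rho>: "0 < \<rho>" "\<rho> < 1"
    and le: "\<And>s t M. delay_trajectory r \<Phi> s \<Longrightarrow> \<forall>\<theta>\<in>{- int r..0}. norm (s \<theta>) \<le> M \<Longrightarrow> norm (s (int t)) \<le> c * \<rho> ^ t * M"
    using stable unfolding exp_stable_iff by blast
  obtain n0 where n0: "\<rho> ^ n0 < 1 / (4 * c)"
    using real_arch_pow_inv[of "1 / (4 * c)" \<rho>] c \<rho> by auto
  define K where "K = max 1 K0"
  have K: "K \<ge> 1" "\<And>y. norm (\<Phi> y) \<le> K * norm y"
    using K0 by (auto simp: K_def intro!: order_trans[OF K0] mult_right_mono)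
  \<comment> \<open>The window ending at \<open>T\<close> lies beyond time \<open>n0\<close>, from which on the nominal decay factor is at
    most \<open>1/4\<close>; the successor makes \<open>T\<close> positive.\<close>
  define T where "T = Suc (n0 + r)"
  define D where "D = 2 * (K + 1)"
  \<comment> \<open>After \<open>n\<close> steps the two trajectories differ by at most \<open>2 n \<epsilon> D ^ n\<close> times the initial
    bound; the factor 8 makes this at most \<open>1/4\<close> at time \<open>T\<close>.\<close>
  define \<epsilon> where "\<epsilon> = min 1 (1 / (8 * real T * D ^ T))"
  have D: "D \<ge> 1" using K by (simp add: D_def)
  have \<epsilon>: "\<epsilon> > 0" "\<epsilon> \<le> 1" and \<epsilon>T: "2 * real T * \<epsilon> * D ^ T \<le> 1 / 4"
  proof -
    have pos: "real T > 0" "D ^ T > 0" using D by (simp_all add: T_def)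
    then show "\<epsilon> > 0" "\<epsilon> \<le> 1" by (simp_all add: \<epsilon>_def)
    have "2 * real T * D ^ T * \<epsilon> \<le> 2 * real T * D ^ T * (1 / (8 * real T * D ^ T))"
      using pos by (intro mult_left_mono) (simp_all add: \<epsilon>_def)
    also have "\<dots> = 1 / 4" using pos D by (simp add: field_simps)
    finally show "2 * real T * \<epsilon> * D ^ T \<le> 1 / 4" by (simp add: mult_ac)
  qed
  have "(\<lambda>t. s (int t)) \<longlonglongrightarrow> 0"
    if close: "\<forall>y. norm (\<Psi> y - \<Phi> y) \<le> \<epsilon> * norm y" and traj: "delay_trajectory r \<Psi> s" for \<Psi> s
  proof -
    have pair: "norm (a, b) \<le> norm a + norm b" for a b :: 'a by (rule norm_Pair_le)
    have \<Psi>: "norm (\<Psi> (a, b)) \<le> (K + 1) * (norm a + norm b)" for a b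
    proof -
      have "norm (\<Psi> (a, b)) \<le> norm (\<Psi> (a, b) - \<Phi> (a, b)) + norm (\<Phi> (a, b))"
        using norm_triangle_ineq[of "\<Psi> (a, b) - \<Phi> (a, b)" "\<Phi> (a, b)"] by simp
      also have "\<dots> \<le> \<epsilon> * norm (a, b) + K * norm (a, b)"
        using close K by (intro add_mono) auto
      also have "\<dots> \<le> 1 * norm (a, b) + K * norm (a, b)"
        using \<epsilon> by (intro add_mono mult_right_mono) auto
      also have "\<dots> = (K + 1) * norm (a, b)" by (simp add: algebra_simps)
      also have "\<dots> \<le> (K + 1) * (norm a + norm b)"
        using K by (intro mult_left_mono pair) auto
      finally show ?thesis .
    qed
    have growth: "norm (s t) \<le> D ^ n * M"
      if "delay_trajectory r \<Psi> s" "\<And>t. - int r \<le> t \<Longrightarrow> t \<le> 0 \<Longrightarrow> norm (s t) \<le> M" "- int r \<le> t" "t \<le> int n"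
      for s M t n
      unfolding D_def using that K \<Psi>
      by (intro delay_growth[where r = r]) (auto simp: delay_trajectory_def)
    \<comment> \<open>The times \<open>T - r, \<dots>, T\<close> form the initial window of the trajectory advanced by \<open>T\<close>.\<close>
    have contraction: "norm (s t) \<le> M / 2"
      if traj: "delay_trajectory r \<Psi> s" and init: "\<And>t. - int r \<le> t \<Longrightarrow> t \<le> 0 \<Longrightarrow> norm (s t) \<le> M"
        and t: "int T - int r \<le> t" "t \<le> int T" for s M t
    proof -
      obtain s0 where s0: "delay_trajectory r \<Phi> s0" and same: "\<And>t. t \<le> 0 \<Longrightarrow> s0 t = s t"
        using delay_trajectory_exists[of r \<Phi> s] by blast
      have "0 \<le> norm (s 0)" by simp
      also have "\<dots> \<le> M" by (rule init) simp_all
      finally have M: "0 \<le> M" .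
      have diff: "norm (s t - s0 t) \<le> 2 * real n * \<epsilon> * D ^ n * M" if "- int r \<le> t" "t \<le> int n" for n t
        using that
      proof (induction n arbitrary: t)
        case 0
        then show ?case by (simp add: same)
      next
        case (Suc n)
        have mono: "2 * real n * \<epsilon> * D ^ n * M \<le> 2 * real (Suc n) * \<epsilon> * D ^ Suc n * M"
          using \<epsilon> D M by (intro mult_right_mono mult_mono power_increasing) auto
        show ?case
        proof (cases "t \<le> int n")
          case True
          then show ?thesis using Suc.IH[of t] Suc.prems mono by linarith
        next
          case False
          then have t: "t = int n + 1" using Suc.prems by simp
          let ?y = "(s (int n), s (int n - int r))" and ?z = "(s0 (int n), s0 (int n - int r))"
          have "s t = \<Psi> ?y" "s0 t = \<Phi> ?z"
            using traj s0 unfolding delay_trajectory_def t by simp_all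
          then have "s t - s0 t = \<Psi> ?y - \<Phi> ?z" by (simp only:)
          also have "\<dots> = (\<Psi> ?y - \<Phi> ?y) + \<Phi> (?y - ?z)"
            unfolding linear_diff[OF lin] by simp
          finally have "norm (s t - s0 t) \<le> norm (\<Psi> ?y - \<Phi> ?y) + norm (\<Phi> (?y - ?z))"
            by (simp only: norm_triangle_ineq)
          also have "\<dots> \<le> \<epsilon> * norm ?y + K * norm (?y - ?z)"
            using close K by (intro add_mono) auto
          also have "\<dots> \<le> \<epsilon> * (D ^ n * M + D ^ n * M) +
              K * (2 * real n * \<epsilon> * D ^ n * M + 2 * real n * \<epsilon> * D ^ n * M)"
          proof (intro add_mono mult_left_mono)
            show "norm ?y \<le> D ^ n * M + D ^ n * M"
              by (intro order_trans[OF pair] add_mono growth[OF traj init]) auto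
            show "norm (?y - ?z) \<le> 2 * real n * \<epsilon> * D ^ n * M + 2 * real n * \<epsilon> * D ^ n * M"
              unfolding diff_Pair
              by (intro order_trans[OF pair] add_mono Suc.IH) auto
          qed (use \<epsilon> K in auto)
          also have "\<dots> = 2 * \<epsilon> * D ^ n * M * (1 + 2 * K * real n)" by (simp add: algebra_simps)
          also have "\<dots> \<le> 2 * \<epsilon> * D ^ n * M * (D + D * real n)"
            using \<epsilon> D M K by (intro mult_left_mono add_mono mult_right_mono) (auto simp: D_def)
          also have "\<dots> = 2 * real (Suc n) * \<epsilon> * D ^ Suc n * M" by (simp add: algebra_simps)
          finally show ?thesis .
        qed
      qed
      obtain k where k: "t = int k" "k \<ge> n0"
        using t by (intro that[of "nat t"]) (auto simp: T_def)
      have "norm (s0 t) \<le> c * \<rho> ^ k * M"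
        unfolding k using init same by (intro le[OF s0]) auto
      also have "\<dots> \<le> c * \<rho> ^ n0 * M"
        using c \<rho> M k by (intro mult_right_mono mult_left_mono power_decreasing) auto
      also have "\<dots> \<le> 1 / 4 * M"
        using n0 c M by (intro mult_right_mono) (auto simp: field_simps)
      finally have "norm (s0 t) \<le> M / 4" by simp
      moreover have "norm (s t - s0 t) \<le> 1 / 4 * M"
      proof (rule order_trans[OF diff mult_right_mono[OF \<epsilon>T M]])
      qed (use t in \<open>auto simp: T_def\<close>)
      moreover have "norm (s t) \<le> norm (s0 t) + norm (s t - s0 t)"
        using norm_triangle_ineq[of "s0 t" "s t - s0 t"] by simp
      ultimately show ?thesis by simp
    qed
    have decay: "norm (s (int n)) \<le> D ^ T * M * (1 / 2) ^ (n div T)"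
      if "delay_trajectory r \<Psi> s" "\<And>t. - int r \<le> t \<Longrightarrow> t \<le> 0 \<Longrightarrow> norm (s t) \<le> M" for s M n
      using that
    proof (induction n arbitrary: s M rule: less_induct)
      case (less n)
      show ?case
      proof (cases "n < T")
        case True
        then show ?thesis using growth[OF less.prems, of "int n" T] by simp
      next
        case False
        have "norm (s (int (n - T) + int T)) \<le> D ^ T * (M / 2) * (1 / 2) ^ ((n - T) div T)"
        proof (rule less.IH)
          show "n - T < n" using False by (simp add: T_def)
          show "delay_trajectory r \<Psi> (\<lambda>t. s (t + int T))" by (rule delay_trajectory_shift[OF less.prems(1)])
          show "norm (s (t + int T)) \<le> M / 2" if "- int r \<le> t" "t \<le> 0" for t
            using that by (intro contraction[OF less.prems]) auto
        qed
        moreover have "n div T = Suc ((n - T) div T)"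
          using False by (simp add: le_div_geq T_def)
        ultimately show ?thesis using False by (simp flip: of_nat_add)
      qed
    qed
    define M where "M = (MAX \<theta>\<in>{- int r..0}. norm (s \<theta>))"
    have "norm (s (int n)) \<le> D ^ T * M * (1 / 2) ^ (n div T)" for n
      unfolding M_def by (intro decay[OF traj] norm_le_window_max) auto
    moreover have "(\<lambda>n. D ^ T * M * (1 / 2) ^ (n div T)) \<longlonglongrightarrow> 0"
    proof -
      have "filterlim (\<lambda>n. n div T) at_top at_top"
        by (rule filterlim_at_top_div_const_nat) (simp add: T_def)
      moreover have "(\<lambda>n. D ^ T * M * (1 / 2) ^ n) \<longlonglongrightarrow> 0"
        by (intro tendsto_mult_right_zero LIMSEQ_realpow_zero) auto
      ultimately show ?thesis by (rule filterlim_compose[rotated])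
    qed
    ultimately show ?thesis
      by (intro Lim_null_comparison[of "\<lambda>n. s (int n)"]) auto
  qed
  then show ?thesis using \<epsilon> by blast
qed

section \<open>The digraph: from virtual errors to regulated outputs\<close>

lemma neighbor_weight_pos:
  "weighted_digraph P \<Longrightarrow> j \<in> neighbors P i \<Longrightarrow> weight P (Some i) j > 0"
  by (auto simp: weighted_digraph_def neighbors_def)

text \<open>
  The discrete maximum principle. Where \<open>g\<close> attains its maximum at a follower, the weighted
  average of the nonnegative differences to its in-neighbours vanishes, so these neighbours attain
  the maximum as well; following a path of the spanning tree backwards leads to the root.
\<close>

lemma root_attains_harmonic_maximum:
  fixes P :: "('n::finite, 'm::finite, 'p::finite, 'q::finite, 'f::finite) mas"
    and g :: "'f option \<Rightarrow> real"
  assumes "weighted_digraph P" and "digraph_connected P"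
    and harmonic: "\<And>i. (\<Sum>j\<in>neighbors P i. weight P (Some i) j * (g (Some i) - g j)) = 0"
  shows "g k \<le> g None"
proof -
  define m where "m = Max (range g)"
  have le: "g j \<le> m" for j unfolding m_def by (rule Max_ge) auto
  have "m \<in> range g" unfolding m_def by (rule Max_in) auto
  then obtain z where z: "g z = m" by auto
  have "(None, z) \<in> (edges P)\<^sup>*"
    using assms(2) unfolding digraph_connected_def directed_spanning_tree_def
    by (meson rtrancl_mono subsetD)
  then have "g None = m" using z
  proof (induction rule: rtrancl_induct)
    case base
    then show ?case .
  next
    case (step y z)
    show ?case
    proof (cases z)
      case None
      then show ?thesis using step.prems by simp
    next
      case (Some i)
      have y: "y \<in> neighbors P i" using step.hyps Some by (simp add: neighbors_def)
      have "\<forall>j\<in>neighbors P i. weight P (Some i) j * (g (Some i) - g j) = 0"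
        using harmonic[of i] le step.prems Some less_imp_le[OF neighbor_weight_pos[OF assms(1)]]
        by (subst (asm) sum_nonneg_eq_0_iff) (auto intro!: mult_nonneg_nonneg)
      then have "g y = g (Some i)" using y neighbor_weight_pos[OF assms(1) y] by auto
      then show ?thesis using step.IH step.prems Some by simp
    qed
  qed
  then show ?thesis using le by simp
qed

lemma linear_net_diff:
  assumes "\<And>j. linear (g j)"
  shows "linear (\<lambda>y. net_diff P (\<lambda>j. g j y) i)"
  unfolding net_diff_def using assms
  by (intro linear_compose_sum ballI linear_compose_scale_right linear_compose_sub) auto

lemma linear_with_leader_0:
  assumes "linear X"
  shows "linear (\<lambda>y. with_leader_0 (X y) j)"
  using assms by (cases j) (auto simp: with_leader_0_def linear_iff)

lemma linear_vec_lambda: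
  assumes "\<And>i. linear (\<lambda>y. g i y)"
  shows "linear (\<lambda>y. \<chi> i. g i y)"
  using assms by (auto simp: linear_iff vec_eq_iff)

text \<open>
  Each component of \<open>e\<close>, extended by the value 0 at the leader, is harmonic on the followers. The
  maximum principle for it and for its negative gives 0 everywhere. In matrix terms: the
  grounded Laplacian of the digraph is nonsingular.
\<close>

lemma net_diff_with_leader_0_inj:
  fixes P :: "('n::finite, 'm::finite, 'p::finite, 'q::finite, 'f::finite) mas"
    and e :: "(real^'d)^'f"
  assumes "weighted_digraph P" and "digraph_connected P"
    and zero: "\<And>i. net_diff P (with_leader_0 e) i = 0"
  shows "e = 0"
proof -
  have "e $ i $ a = 0" for i a
  proof -
    \<comment> \<open>The factor \<open>c\<close> is taken to be 1 for the upper and -1 for the lower bound.\<close>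
    define g where "g c j = c * with_leader_0 e j $ a" for c :: real and j
    have harmonic: "(\<Sum>j\<in>neighbors P i. weight P (Some i) j * (g c (Some i) - g c j)) = 0" for c i
    proof -
      have "(\<Sum>j\<in>neighbors P i. weight P (Some i) j * (g c (Some i) - g c j))
          = c * net_diff P (with_leader_0 e) i $ a"
        by (simp add: g_def net_diff_def sum_distrib_left algebra_simps)
      then show ?thesis using zero by simp
    qed
    show ?thesis
      using root_attains_harmonic_maximum[OF assms(1,2) harmonic[where c = 1], of "Some i"]
        root_attains_harmonic_maximum[OF assms(1,2) harmonic[where c = "-1"], of "Some i"]
      by (simp add: g_def with_leader_0_def)
  qed
  then show ?thesis by (simp add: vec_eq_iff)
qed

text \<open>
  The differences of outputs in the virtual error do not change when the leader's output is
  subtracted from all of them.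
\<close>

lemma virtual_error_regulated_output:
  "virtual_error P w v x i t = net_diff P (with_leader_0 (\<chi> k. regulated_output P w v x k t)) i"
  unfolding virtual_error_def net_diff_def
  by (intro sum.cong) (auto simp: with_leader_0_def regulated_output_def split: option.splits)

lemma regulated_output_tendsto_0:
  fixes P :: "('n::finite, 'm::finite, 'p::finite, 'q::finite, 'f::finite) mas"
  assumes "weighted_digraph P" and "digraph_connected P"
    and ve: "\<And>i. (\<lambda>t::nat. virtual_error P w v x i (int t)) \<longlonglongrightarrow> 0"
  shows "(\<lambda>t::nat. regulated_output P w v x i (int t)) \<longlonglongrightarrow> 0"
proof -
  define H :: "(real^'p)^'f \<Rightarrow> (real^'p)^'f" where "H e = (\<chi> i. net_diff P (with_leader_0 e) i)" for e
  have "linear H"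
    unfolding H_def by (intro linear_vec_lambda linear_net_diff linear_with_leader_0 linear_ident)
  moreover have "inj H"
    using \<open>linear H\<close> net_diff_with_leader_0_inj[OF assms(1,2)]
    by (subst linear_injective_0) (auto simp: H_def vec_eq_iff)
  ultimately obtain B where B: "B > 0" "\<And>e. B * norm e \<le> norm (H e)"
    using linear_inj_bounded_below_pos by blast
  define e where "e t = (\<chi> k. regulated_output P w v x k (int t))" for t
  have "(\<lambda>t. H (e t)) \<longlonglongrightarrow> 0"
  proof (rule vec_tendstoI)
    fix i
    show "(\<lambda>t. H (e t) $ i) \<longlonglongrightarrow> 0 $ i"
      using ve[of i] by (simp add: H_def e_def virtual_error_regulated_output)
  qed
  then have "(\<lambda>t. norm (H (e t)) / B) \<longlonglongrightarrow> 0"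
    by (intro tendsto_divide_zero tendsto_norm_zero)
  then have "e \<longlonglongrightarrow> 0"
  proof (rule Lim_null_comparison[rotated])
    show "\<forall>\<^sub>F t in sequentially. norm (e t) \<le> norm (H (e t)) / B"
      using B by (auto simp: field_simps)
  qed
  then have "(\<lambda>t. e t $ i) \<longlonglongrightarrow> 0 $ i" by (rule tendsto_vec_nth)
  then show ?thesis by (simp add: e_def)
qed

section \<open>The internal model recovers its input\<close>

lemma poly_mat_mult_vec:
  "poly_mat f M *v x = (\<Sum>k\<le>degree f. coeff f k *\<^sub>R (matpow M k *v x))"
proof -
  have "linear (\<lambda>A. A *v x)"
    by (rule linearI) (simp_all add: matrix_vector_mult_add_rdistrib scaleR_matrix_vector_assoc)
  from linear_sum[OF this] show ?thesis
    by (simp add: poly_mat_def scaleR_matrix_vector_assoc)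
qed

text \<open>
  The polynomial \<open>f\<close> in the forward shift, applied to the signal \<open>s\<close>. As an operator it commutes
  with linear maps and with time shifts, and it kills the solutions of \<open>\<zeta> (t + 1) = M \<zeta> t\<close> if \<open>f\<close>
  annihilates \<open>M\<close>.
\<close>

definition filtered :: "real poly \<Rightarrow> (int \<Rightarrow> 'a::real_vector) \<Rightarrow> int \<Rightarrow> 'a" where
  "filtered f s t = (\<Sum>k\<le>degree f. coeff f k *\<^sub>R s (t + int k))"

lemma linear_filtered:
  "linear h \<Longrightarrow> h (filtered f s t) = filtered f (\<lambda>t. h (s t)) t"
  by (simp add: filtered_def linear_sum linear_scale)

lemma filtered_Pair:
  "filtered f (\<lambda>t. (a t, b t)) t = (filtered f a t, filtered f b t)"
  by (simp add: filtered_def prod_eq_iff fst_sum snd_sum)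

text \<open>
  Variation of constants.
\<close>

lemma driven_recurrence:
  fixes \<zeta> :: "int \<Rightarrow> real^'k"
  assumes step: "\<And>t. t \<ge> 0 \<Longrightarrow> \<zeta> (t + 1) = M *v \<zeta> t + e t *\<^sub>R b" and "t \<ge> 0"
  shows "\<zeta> (t + int k) = matpow M k *v \<zeta> t + (\<Sum>j<k. e (t + int j) *\<^sub>R (matpow M (k - 1 - j) *v b))"
proof (induction k)
  case 0
  then show ?case by simp
next
  case (Suc k)
  have "\<zeta> (t + int (Suc k)) = M *v \<zeta> (t + int k) + e (t + int k) *\<^sub>R b"
    using step[of "t + int k"] \<open>t \<ge> 0\<close> by (simp add: algebra_simps)
  also have "M *v \<zeta> (t + int k) = matpow M (Suc k) *v \<zeta> t
      + (\<Sum>j<k. e (t + int j) *\<^sub>R (M *v (matpow M (k - 1 - j) *v b)))"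
    unfolding Suc.IH
    by (simp add: matrix_vector_right_distrib matrix_vector_mult_scaleR matrix_vector_mul_assoc
        linear_sum[OF matrix_vector_mul_linear])
  also have "(\<Sum>j<k. e (t + int j) *\<^sub>R (M *v (matpow M (k - 1 - j) *v b)))
      = (\<Sum>j<k. e (t + int j) *\<^sub>R (matpow M (Suc k - 1 - j) *v b))"
  proof (intro sum.cong refl)
    fix j assume "j \<in> {..<k}"
    then have "Suc k - 1 - j = Suc (k - 1 - j)" by auto
    then show "e (t + int j) *\<^sub>R (M *v (matpow M (k - 1 - j) *v b))
        = e (t + int j) *\<^sub>R (matpow M (Suc k - 1 - j) *v b)"
      by (simp add: matrix_vector_mul_assoc)
  qed
  finally show ?case by (simp add: algebra_simps)
qed

lemma autonomous_recurrence_annihilated: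
  fixes \<zeta> :: "int \<Rightarrow> real^'k"
  assumes step: "\<And>t. t \<ge> 0 \<Longrightarrow> \<zeta> (t + 1) = M *v \<zeta> t" and "t \<ge> 0" and "poly_mat f M = 0"
  shows "filtered f \<zeta> t = 0"
proof -
  have "\<zeta> (t + int k) = matpow M k *v \<zeta> t" for k
    using driven_recurrence[of \<zeta> M "\<lambda>_. 0" 0 t k] assms by simp
  then show ?thesis
    using poly_mat_mult_vec[of f M "\<zeta> t"] assms(3) by (simp add: filtered_def)
qed

text \<open>
  Filtering with an annihilating polynomial \<open>f\<close> of degree \<open>d\<close> removes the free response and leaves
  the sum of \<open>f\<^sub>k e(t + j) M\<^sup>k\<^sup>-\<^sup>1\<^sup>-\<^sup>j b\<close> over \<open>j < k \<le> d\<close>. The power \<open>d - 1\<close> of \<open>M\<close> occurs only for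
  \<open>k = d\<close> and \<open>j = 0\<close>, with coefficient 1, so a functional which sees only this power
  returns \<open>e t\<close>.
\<close>

lemma internal_model_recovers_input:
  fixes \<zeta> :: "int \<Rightarrow> real^'k" and g :: "real^'k \<Rightarrow> real"
  assumes step: "\<And>t. t \<ge> 0 \<Longrightarrow> \<zeta> (t + 1) = M *v \<zeta> t + e t *\<^sub>R b" and "t \<ge> 0"
    and f: "poly_mat f M = 0" "lead_coeff f = 1" "degree f \<ge> 1"
    and g: "linear g" "\<And>l. l \<le> degree f - 1 \<Longrightarrow> g (matpow M l *v b) = (if l = degree f - 1 then 1 else 0)"
  shows "g (filtered f \<zeta> t) = e t"
proof -
  let ?R = "\<lambda>k. \<Sum>j<k. e (t + int j) *\<^sub>R (matpow M (k - 1 - j) *v b)"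
  have rec: "\<zeta> (t + int k) = matpow M k *v \<zeta> t + ?R k" for k
    by (rule driven_recurrence) (use step \<open>t \<ge> 0\<close> in auto)
  have "filtered f \<zeta> t
      = (\<Sum>k\<le>degree f. coeff f k *\<^sub>R (matpow M k *v \<zeta> t)) + (\<Sum>k\<le>degree f. coeff f k *\<^sub>R ?R k)"
    unfolding filtered_def rec
    by (simp add: scaleR_right_distrib sum.distrib)
  also have "\<dots> = (\<Sum>k\<le>degree f. coeff f k *\<^sub>R ?R k)"
    unfolding poly_mat_mult_vec[symmetric] f(1) by simp
  finally have "g (filtered f \<zeta> t) = (\<Sum>k\<le>degree f. coeff f k * g (?R k))"
    by (simp add: linear_sum[OF g(1)] linear_scale[OF g(1)])
  also have "\<dots> = (\<Sum>k\<le>degree f. if k = degree f then e t else 0)"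
  proof (intro sum.cong refl)
    fix k assume k: "k \<in> {..degree f}"
    have "g (?R k) = (\<Sum>j<k. e (t + int j) * g (matpow M (k - 1 - j) *v b))"
      by (simp add: linear_sum[OF g(1)] linear_scale[OF g(1)])
    also have "\<dots> = (\<Sum>j<k. if j = 0 \<and> k = degree f then e t else 0)"
    proof (intro sum.cong refl)
      fix j assume j: "j \<in> {..<k}"
      then have "k - 1 - j = degree f - 1 \<longleftrightarrow> j = 0 \<and> k = degree f" using k f(3) by auto
      moreover have "k - 1 - j \<le> degree f - 1" using k by auto
      ultimately show "e (t + int j) * g (matpow M (k - 1 - j) *v b)
          = (if j = 0 \<and> k = degree f then e t else 0)"
        using g(2)[of "k - 1 - j"] by auto
    qed
    also have "\<dots> = (if k = degree f then e t else 0)"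
      using f(3) by (cases "k = degree f") auto
    finally show "coeff f k * g (?R k) = (if k = degree f then e t else 0)" using f(2) by simp
  qed
  finally show ?thesis by simp
qed

text \<open>
  The next two facts say that the \<open>p\<close>-copy internal model is \<open>p\<close> uncoupled copies of \<open>(\<beta>, \<sigma>)\<close>, the
  \<open>a\<close>-th one being driven by the \<open>a\<close>-th component of the input.
\<close>

lemma kron_mat_1_mult_vec:
  "(kron (mat 1) \<beta> *v z) $ (a, b) = (\<beta> *v (\<chi> b'. z $ (a, b'))) $ b"
proof -
  have "(kron (mat 1) \<beta> *v z) $ (a, b) = (\<Sum>a'\<in>UNIV. \<Sum>b'\<in>UNIV. mat 1 $ a $ a' * \<beta> $ b $ b' * z $ (a', b'))"
    by (simp add: matrix_vector_mult_def kron_def sum.cartesian_product case_prod_beta)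
  also have "\<dots> = (\<Sum>a'\<in>UNIV. if a = a' then \<Sum>b'\<in>UNIV. \<beta> $ b $ b' * z $ (a', b') else 0)"
    by (intro sum.cong refl) (simp add: mat_def)
  finally show ?thesis by (simp add: matrix_vector_mult_def)
qed

lemma kron_col_mat_1_mult_vec:
  "(kron_col (mat 1) \<sigma> *v y) $ (a, b) = y $ a * \<sigma> $ b"
  by (simp add: matrix_vector_mult_def kron_col_def mat_def if_distrib if_distribR mult_ac cong: if_cong)

section \<open>Regulation for a closed loop with a linear step map\<close>

text \<open>
  Pointwise continuity of a family of linear maps is uniform on bounded sets in finite dimension,
  since it suffices to control the images of the basis vectors.
\<close>

lemma linear_family_close:
  fixes \<Phi> :: "'w::real_normed_vector \<Rightarrow> 'y::euclidean_space \<Rightarrow> 'a::real_normed_vector"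
  assumes lin: "\<And>w. linear (\<Phi> w)"
    and cont: "\<And>y. ((\<lambda>w. \<Phi> w y) \<longlongrightarrow> \<Phi> 0 y) (nhds 0)"
    and "\<epsilon> > 0"
  shows "\<forall>\<^sub>F w in nhds 0. \<forall>y. norm (\<Phi> w y - \<Phi> 0 y) \<le> \<epsilon> * norm y"
proof -
  define \<delta> where "\<delta> = \<epsilon> / DIM('y)"
  have "\<delta> > 0" using \<open>\<epsilon> > 0\<close> by (simp add: \<delta>_def)
  have "\<forall>\<^sub>F w in nhds 0. \<forall>b\<in>Basis. dist (\<Phi> w b) (\<Phi> 0 b) < \<delta>"
    using cont \<open>\<delta> > 0\<close> by (intro eventually_ball_finite) (auto simp: tendsto_iff)
  then show ?thesis
  proof (rule eventually_mono, intro allI)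
    fix w y assume close: "\<forall>b\<in>Basis. dist (\<Phi> w b) (\<Phi> 0 b) < \<delta>"
    have expand: "\<Phi> w' y = (\<Sum>b\<in>Basis. (y \<bullet> b) *\<^sub>R \<Phi> w' b)" for w'
      by (subst euclidean_representation[of y, symmetric])
        (simp only: linear_sum[OF lin] linear_scale[OF lin])
    have "norm (\<Phi> w y - \<Phi> 0 y) = norm (\<Sum>b\<in>Basis. (y \<bullet> b) *\<^sub>R (\<Phi> w b - \<Phi> 0 b))"
      unfolding expand by (simp add: sum_subtractf scaleR_diff_right)
    also have "\<dots> \<le> (\<Sum>b\<in>(Basis::'y set). norm y * \<delta>)"
    proof (rule sum_norm_le)
      fix b :: 'y assume b: "b \<in> Basis"
      then have "norm (\<Phi> w b - \<Phi> 0 b) \<le> \<delta>" using close by (auto simp: dist_norm)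
      then show "norm ((y \<bullet> b) *\<^sub>R (\<Phi> w b - \<Phi> 0 b)) \<le> norm y * \<delta>"
        using b by (auto simp: Basis_le_norm intro!: mult_mono)
    qed
    also have "\<dots> = \<epsilon> * norm y" by (simp add: \<delta>_def)
    finally show "norm (\<Phi> w y - \<Phi> 0 y) \<le> \<epsilon> * norm y" .
  qed
qed

text \<open>
  What the two closed loops have in common. Their equations contain \<open>x\<close>, \<open>zb\<close> and \<open>\<xi>\<close> either
  undelayed or after both delays have acted, so the next state depends on the present state and on the state
  \<open>rcom + rcon\<close> steps ago only. It depends linearly on these and on \<open>v\<close>, and continuously on \<open>w\<close>.
\<close>

locale linear_closed_loop =
  fixes P :: "('n::finite, 'm::finite, 'p::finite, 'q::finite, 'f::finite) mas"
    and CL :: "('n, 'm, 'p, 'q, 'f, 'c::euclidean_space) closed_loop"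
    and Step :: "('n, 'm, 'p, 'q, 'f) uncertainty \<Rightarrow>
      (real^'q) \<times> (((real^'n)^'f) \<times> 'c) \<times> (((real^'n)^'f) \<times> 'c) \<Rightarrow> ((real^'n)^'f) \<times> 'c"
  assumes linear_Step: "linear (Step w)"
    and Step_tendsto: "((\<lambda>w. Step w y) \<longlongrightarrow> Step 0 y) (nhds 0)"
    and loop_iff: "CL w v x c \<longleftrightarrow> (\<forall>t\<ge>0. (x (t + 1), c (t + 1)) =
      Step w (v t, (x t, c t), (x (t - int (rcom P + rcon P)), c (t - int (rcom P + rcon P)))))"
begin

abbreviation delay :: nat where "delay \<equiv> rcom P + rcon P"

definition unforced_step :: "('n, 'm, 'p, 'q, 'f) uncertainty \<Rightarrow>
    (((real^'n)^'f) \<times> 'c) \<times> (((real^'n)^'f) \<times> 'c) \<Rightarrow> ((real^'n)^'f) \<times> 'c" where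
  "unforced_step w y = Step w (0, y)"

lemma linear_unforced_step: "linear (unforced_step w)"
  unfolding unforced_step_def
  using linear_compose[OF _ linear_Step[of w], of "\<lambda>y. (0, y)"]
  by (simp add: o_def linear_iff)

lemma nominal_trajectories:
  "{\<lambda>t. (x t, c t) | x c. CL 0 (\<lambda>_. 0) x c} = {s. delay_trajectory delay (unforced_step 0) s}"
proof (intro equalityI subsetI; clarsimp)
  fix x c assume "CL 0 (\<lambda>_. 0) x c"
  then show "delay_trajectory delay (unforced_step 0) (\<lambda>t. (x t, c t))"
    by (simp add: delay_trajectory_def unforced_step_def loop_iff)
next
  fix s :: "int \<Rightarrow> ((real^'n)^'f) \<times> 'c" assume "delay_trajectory delay (unforced_step 0) s"
  then have "CL 0 (\<lambda>_. 0) (\<lambda>t. fst (s t)) (\<lambda>t. snd (s t))"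
    by (simp add: delay_trajectory_def unforced_step_def loop_iff)
  then show "\<exists>x c. s = (\<lambda>t. (x t, c t)) \<and> CL 0 (\<lambda>_. 0) x c"
    by (intro exI[of _ "\<lambda>t. fst (s t)"] exI[of _ "\<lambda>t. snd (s t)"]) simp
qed

text \<open>
  The assumption on \<open>AUX\<close> asks for a simulation: every trajectory of the loop yields one of the
  auxiliary loop which differs from it by advancing some components by \<open>m\<close> steps.
\<close>

lemma nominal_exp_stable_of_auxiliary:
  fixes AUX :: "('n, 'm, 'p, 'q, 'f, 'd::real_normed_vector) closed_loop"
  assumes stable: "nominal_exp_stable P AUX"
    and aux: "\<And>x c. CL 0 (\<lambda>_. 0) x c \<Longrightarrow>
      \<exists>x' c'. AUX 0 (\<lambda>_. 0) x' c' \<and>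
        (\<forall>t. norm (x' t, c' t) \<le> 2 * (norm (x (t + int m), c (t + int m)) + norm (x t, c t)) \<and>
             norm (x (t + int m), c (t + int m)) \<le> 2 * (norm (x' t, c' t) + norm (x' (t + int m), c' (t + int m))))"
  shows "nominal_exp_stable P CL"
proof -
  obtain K0 where K0: "\<And>y. norm (unforced_step 0 y) \<le> K0 * norm y"
    using linear_bounded[OF linear_unforced_step] by blast
  have growth: "norm (s (t + 1)) \<le> max 1 K0 * (norm (s t) + norm (s (t - int delay)))"
    if "delay_trajectory delay (unforced_step 0) s" "t \<ge> 0" for s t
  proof -
    have "norm (s (t + 1)) \<le> K0 * norm (s t, s (t - int delay))"
      using that K0 by (simp add: delay_trajectory_def)
    also have "\<dots> \<le> max 1 K0 * (norm (s t) + norm (s (t - int delay)))"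
      by (intro mult_mono norm_Pair_le) auto
    finally show ?thesis .
  qed
  show ?thesis
    unfolding nominal_exp_stable_def
  proof (rule exp_stable_transfer[OF stable[unfolded nominal_exp_stable_def], of "max 1 K0" _ m])
    fix s assume "s \<in> {\<lambda>t. (x t, c t) | x c. CL 0 (\<lambda>_. 0) x c}"
    then obtain x c where s: "s = (\<lambda>t. (x t, c t))" and "CL 0 (\<lambda>_. 0) x c" by blast
    from aux[OF this(2)] obtain x' c' where "AUX 0 (\<lambda>_. 0) x' c'" and
      "\<forall>t. norm (x' t, c' t) \<le> 2 * (norm (s (t + int m)) + norm (s t)) \<and>
        norm (s (t + int m)) \<le> 2 * (norm (x' t, c' t) + norm (x' (t + int m), c' (t + int m)))"
      unfolding s by blast
    then show
      "\<exists>s'\<in>{\<lambda>t. (x t, c t) |x c. AUX 0 (\<lambda>_. 0) x c}. \<forall>t.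
         norm (s' t) \<le> 2 * (norm (s (t + int m)) + norm (s t)) \<and>
         norm (s (t + int m)) \<le> 2 * (norm (s' t) + norm (s' (t + int m)))"
      by (intro bexI[of _ "\<lambda>t. (x' t, c' t)"]) auto
  qed (use growth in \<open>simp_all add: nominal_trajectories\<close>)
qed

text \<open>
  The exogenous signal enters the loop linearly and is killed by a polynomial that annihilates
  \<open>S\<close>, so filtering turns a trajectory driven by the exosystem into an unforced one.
\<close>

lemma filtered_trajectory_unforced:
  assumes "exosystem P v" and "CL w v x c" and "poly_mat f (Smat P) = 0"
  shows "delay_trajectory delay (unforced_step w) (filtered f (\<lambda>t. (x t, c t)))"
  unfolding delay_trajectory_def
proof (intro allI impI)
  fix t :: int assume "t \<ge> 0"
  let ?s = "\<lambda>t. (x t, c t)"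
  have "filtered f v t = 0"
    using assms(1,3) \<open>t \<ge> 0\<close>
    by (intro autonomous_recurrence_annihilated) (auto simp: exosystem_def)
  have "filtered f ?s (t + 1)
      = (\<Sum>k\<le>degree f. coeff f k *\<^sub>R Step w (v (t + int k), ?s (t + int k), ?s (t + int k - int delay)))"
    unfolding filtered_def
  proof (intro sum.cong refl arg_cong[where f = "scaleR _"])
    fix k
    have "t + int k \<ge> 0" using \<open>t \<ge> 0\<close> by simp
    then show "?s (t + 1 + int k) = Step w (v (t + int k), ?s (t + int k), ?s (t + int k - int delay))"
      using assms(2)[unfolded loop_iff, rule_format, of "t + int k"] by (simp add: algebra_simps)
  qed
  also have "\<dots> = filtered f (\<lambda>t. Step w (v t, ?s t, ?s (t - int delay))) t"
    by (simp add: filtered_def)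
  also have "\<dots> = Step w (filtered f v t, filtered f ?s t, filtered f (\<lambda>t. ?s (t - int delay)) t)"
    by (simp only: linear_filtered[OF linear_Step, symmetric] filtered_Pair)
  also have "filtered f (\<lambda>t. ?s (t - int delay)) t = filtered f ?s (t - int delay)"
    by (simp add: filtered_def algebra_simps)
  finally show "filtered f ?s (t + 1) = unforced_step w (filtered f ?s t, filtered f ?s (t - int delay))"
    unfolding \<open>filtered f v t = 0\<close> unforced_step_def .
qed

text \<open>
  Let \<open>f\<close> be the common polynomial of \<open>\<beta>\<close> and \<open>S\<close>. A trajectory filtered with \<open>f\<close> is an unforced
  trajectory and tends to 0 for small \<open>w\<close> by robustness of stability. The virtual error is a
  linear function of the filtered internal model state, hence tends to 0, and with it the
  regulated output.
\<close>

theorem regulation_by_internal_model: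
  fixes G1 :: "real^('p \<times> 'k::finite)^('p \<times> 'k)" and G2 :: "real^'p^('p \<times> 'k)"
    and Z :: "'c \<Rightarrow> (real^('p \<times> 'k))^'f"
  assumes graph: "weighted_digraph P" "digraph_connected P"
    and internal_model: "minimal_p_copy_internal_model (Smat P) G1 G2"
    and Z: "linear Z" "\<And>w v x c. CL w v x c \<Longrightarrow> zbar_eqs P G1 G2 w v x (\<lambda>t. Z (c t))"
    and stable: "nominal_exp_stable P CL"
  shows "solves_coop_robust_output_regulation P CL"
proof -
  obtain \<beta> :: "real^'k^'k" and \<sigma> where G1: "G1 = kron (mat 1) \<beta>" and G2: "G2 = kron_col (mat 1) \<sigma>"
    and min: "is_minimal_poly (charac_poly \<beta>) (Smat P)" and ctrl: "controllable \<beta> \<sigma>"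
    using internal_model unfolding minimal_p_copy_internal_model_def by blast
  define f where "f = charac_poly \<beta>"
  have f: "lead_coeff f = 1" "poly_mat f (Smat P) = 0" "poly_mat f \<beta> = 0"
    using min by (auto simp: f_def is_minimal_poly_def cayley_hamilton)
  have deg: "degree f \<ge> 1"
  proof (rule ccontr)
    assume "\<not> degree f \<ge> 1"
    then have "degree f = 0" by simp
    \<comment> \<open>A monic constant polynomial would take the value \<open>mat 1\<close> at \<open>S\<close>.\<close>
    then have "poly_mat f (Smat P) = mat 1" using f(1) by (simp add: poly_mat_def)
    then have "(mat 1 :: real^'q^'q) = 0" using f(2) by simp
    then have "(mat 1 :: real^'q^'q) $ undefined $ undefined = 0" by simp
    then show False by (simp add: mat_def)
  qed
  have "degree f \<le> CARD('k)" by (simp add: f_def degree_charac_poly_le)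
  with deg have "degree f - 1 < CARD('k)" by linarith
  then obtain g :: "real^'k \<Rightarrow> real" where g: "linear g"
      "\<And>l. l \<le> degree f - 1 \<Longrightarrow> g (matpow \<beta> l *v \<sigma>) = (if l = degree f - 1 then 1 else 0)"
    using controllable_dual_functional[OF ctrl] by blast
  obtain \<epsilon> where "\<epsilon> > 0" and robust: "\<And>\<Psi> s. \<forall>y. norm (\<Psi> y - unforced_step 0 y) \<le> \<epsilon> * norm y \<Longrightarrow>
      delay_trajectory delay \<Psi> s \<Longrightarrow> (\<lambda>t. s (int t)) \<longlonglongrightarrow> 0"
    using exp_stable_robust[OF linear_unforced_step, of delay 0] stable
    unfolding nominal_exp_stable_def nominal_trajectories by blast
  have "\<forall>\<^sub>F w in nhds 0. \<forall>y. norm (unforced_step w y - unforced_step 0 y) \<le> \<epsilon> * norm y"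
    using Step_tendsto \<open>\<epsilon> > 0\<close>
    by (intro linear_family_close linear_unforced_step) (simp_all add: unforced_step_def)
  then obtain W where W: "open W" "0 \<in> W"
    and close: "\<And>w. w \<in> W \<Longrightarrow> \<forall>y. norm (unforced_step w y - unforced_step 0 y) \<le> \<epsilon> * norm y"
    unfolding eventually_nhds by blast
  have "(\<lambda>t. regulated_output P w v x i (int t)) \<longlonglongrightarrow> 0"
    if w: "w \<in> W" and exo: "exosystem P v" and CL: "CL w v x c" for w v x c i
  proof (rule regulated_output_tendsto_0[OF graph])
    fix i
    let ?s = "filtered f (\<lambda>t. (x t, c t))"
    have s: "(\<lambda>t. ?s (int t)) \<longlonglongrightarrow> 0"
      using robust[OF close[OF w] filtered_trajectory_unforced[OF exo CL f(2)]] .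
    show "(\<lambda>t. virtual_error P w v x i (int t)) \<longlonglongrightarrow> 0"
    proof (rule vec_tendstoI)
      fix a
      define h :: "((real^'n)^'f) \<times> 'c \<Rightarrow> real^'k" where "h y = (\<chi> b. Z (snd y) $ i $ (a, b))" for y
      have h: "linear h"
        using Z(1) by (auto simp: linear_iff h_def vec_eq_iff)
      have copy: "h (x (t + 1), c (t + 1)) = \<beta> *v h (x t, c t) + virtual_error P w v x i t $ a *\<^sub>R \<sigma>"
        if "t \<ge> 0" for t
        using Z(2)[OF CL] that
        by (simp add: zbar_eqs_def h_def vec_eq_iff G1 G2 kron_mat_1_mult_vec kron_col_mat_1_mult_vec)
      have "g (h (?s (int t))) = virtual_error P w v x i (int t) $ a" for t
        unfolding linear_filtered[OF h]
        by (rule internal_model_recovers_input[OF _ _ f(3,1) deg g,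
              where e = "\<lambda>t. virtual_error P w v x i t $ a"]) (use copy in auto)
      moreover have "linear (\<lambda>y. g (h y))" using linear_compose[OF h g(1)] by (simp add: o_def)
      then have "bounded_linear (\<lambda>y. g (h y))" by (simp add: linear_conv_bounded_linear)
      then have "(\<lambda>t. g (h (?s (int t)))) \<longlonglongrightarrow> 0"
        by (rule bounded_linear.tendsto_zero) (rule s)
      ultimately show "(\<lambda>t. virtual_error P w v x i (int t) $ a) \<longlonglongrightarrow> 0 $ a" by simp
    qed
  qed
  then show ?thesis
    unfolding solves_coop_robust_output_regulation_def using stable W by blast
qed

end

section \<open>The two closed loops as linear recurrences\<close>

lemma linear_matrix_vector: "linear g \<Longrightarrow> linear (\<lambda>y. M *v g y)"
  for M :: "real^'a^'b"
  using linear_compose[of g "\<lambda>x. M *v x"] by (simp add: o_def)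

lemma linear_component: "linear g \<Longrightarrow> linear (\<lambda>y. g y $ i)"
  for g :: "'y::real_vector \<Rightarrow> 'b::real_vector^'i"
  by (simp add: linear_iff)

lemma linear_fst_of: "linear g \<Longrightarrow> linear (\<lambda>y. fst (g y))"
  and linear_snd_of: "linear g \<Longrightarrow> linear (\<lambda>y. snd (g y))"
  by (simp_all add: linear_iff)

lemma linear_Pair: "linear g \<Longrightarrow> linear h \<Longrightarrow> linear (\<lambda>y. (g y, h y))"
  by (simp add: linear_iff)

lemmas linear_signal_intros =
  linear_ident linear_matrix_vector linear_component linear_fst_of linear_snd_of linear_Pair
  linear_vec_lambda linear_net_diff linear_with_leader_0 linear_compose_add linear_compose_sub

lemma tendsto_matrix_vector:
  fixes M :: "'w \<Rightarrow> real^'a^'b"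
  assumes "(M \<longlongrightarrow> M0) F" and "(y \<longlongrightarrow> y0) F"
  shows "((\<lambda>w. M w *v y w) \<longlongrightarrow> M0 *v y0) F"
  unfolding matrix_vector_mult_def using assms
  by (intro tendsto_vec_lambda tendsto_sum tendsto_mult tendsto_vec_nth)

lemma tendsto_net_diff:
  assumes "\<And>j. ((\<lambda>w. g w j) \<longlongrightarrow> g0 j) F"
  shows "((\<lambda>w. net_diff P (g w) i) \<longlongrightarrow> net_diff P g0 i) F"
  unfolding net_diff_def using assms by (intro tendsto_intros)

lemma tendsto_perturbed_matrices:
  "((\<lambda>w. Abar P w i) \<longlongrightarrow> Abar P w0 i) (nhds w0)"
  "((\<lambda>w. Bbar P w i) \<longlongrightarrow> Bbar P w0 i) (nhds w0)"
  "((\<lambda>w. Ebar P w i) \<longlongrightarrow> Ebar P w0 i) (nhds w0)"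
  "((\<lambda>w. Cbar P w i) \<longlongrightarrow> Cbar P w0 i) (nhds w0)"
  unfolding Abar_def Bbar_def Ebar_def Cbar_def case_prod_beta
  by (intro tendsto_intros tendsto_vec_nth filterlim_ident)+

text \<open>
  The virtual error as a function of the current values \<open>v\<close> and \<open>X\<close> of the exogenous signal and of
  the plant states.
\<close>

definition mismatch ::
  "('n::finite,'m::finite,'p::finite,'q::finite,'f::finite) mas \<Rightarrow>
   ('n,'m,'p,'q,'f) uncertainty \<Rightarrow> real^'q \<Rightarrow> (real^'n)^'f \<Rightarrow> 'f \<Rightarrow> real^'p" where
  "mismatch P w v X = net_diff P (\<lambda>j. case j of None \<Rightarrow> - (Fmat P *v v) | Some k \<Rightarrow> Cbar P w k *v (X $ k))"

text \<open>
  In the step maps \<open>U\<close> stands for the inputs that reach the plants now, i.e. those computed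
  \<open>rcon\<close> steps ago.
\<close>

definition plant_step ::
  "('n::finite,'m::finite,'p::finite,'q::finite,'f::finite) mas \<Rightarrow>
   ('n,'m,'p,'q,'f) uncertainty \<Rightarrow> real^'q \<Rightarrow> (real^'n)^'f \<Rightarrow> ('f \<Rightarrow> real^'m) \<Rightarrow> (real^'n)^'f" where
  "plant_step P w v X U = (\<chi> i. Abar P w i *v (X $ i) + Bbar P w i *v U i + Ebar P w i *v v)"

definition zbar_step ::
  "('n::finite,'m::finite,'p::finite,'q::finite,'f::finite) mas \<Rightarrow> real^'s^'s \<Rightarrow> real^'p^'s \<Rightarrow>
   ('n,'m,'p,'q,'f) uncertainty \<Rightarrow> real^'q \<Rightarrow> (real^'n)^'f \<Rightarrow> (real^'s)^'f \<Rightarrow> (real^'s)^'f" where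
  "zbar_step P G1 G2 w v X Z = (\<chi> i. G1 *v (Z $ i) + G2 *v mismatch P w v X i)"

definition observer_step ::
  "('n::finite,'m::finite,'p::finite,'q::finite,'f::finite) mas \<Rightarrow> real^'p^'n \<Rightarrow>
   ('n,'m,'p,'q,'f) uncertainty \<Rightarrow> real^'q \<Rightarrow> (real^'n)^'f \<Rightarrow> ('f \<Rightarrow> real^'m) \<Rightarrow> (real^'n)^'f \<Rightarrow>
   (real^'n)^'f" where
  "observer_step P L w v X U \<Xi> = (\<chi> i. Anom P *v (\<Xi> $ i) + Bnom P *v U i
     - (L ** Cnom P) *v net_diff P (with_leader_0 \<Xi>) i + L *v mismatch P w v X i)"

lemma virtual_error_mismatch: "virtual_error P w v x i t = mismatch P w (v t) (x t) i"
  by (simp add: virtual_error_def mismatch_def node_output_def)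

lemma linear_mismatch:
  assumes "linear v" "linear X"
  shows "linear (\<lambda>y. mismatch P w (v y) (X y) i)"
  unfolding mismatch_def
proof (intro linear_net_diff)
  fix j
  show "linear (\<lambda>y. case j of None \<Rightarrow> - (Fmat P *v v y) | Some k \<Rightarrow> Cbar P w k *v (X y $ k))"
    using assms by (cases j) (auto intro!: linear_signal_intros linear_compose_neg)
qed

lemma linear_plant_step:
  assumes "linear v" "linear X" "\<And>i. linear (\<lambda>y. U y i)"
  shows "linear (\<lambda>y. plant_step P w (v y) (X y) (U y))"
  unfolding plant_step_def using assms by (auto intro!: linear_signal_intros)

lemma linear_zbar_step:
  assumes "linear v" "linear X" "linear Z"
  shows "linear (\<lambda>y. zbar_step P G1 G2 w (v y) (X y) (Z y))"
  unfolding zbar_step_def using assms by (auto intro!: linear_signal_intros linear_mismatch)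

lemma linear_observer_step:
  assumes "linear v" "linear X" "\<And>i. linear (\<lambda>y. U y i)" "linear \<Xi>"
  shows "linear (\<lambda>y. observer_step P L w (v y) (X y) (U y) (\<Xi> y))"
  unfolding observer_step_def using assms by (auto intro!: linear_signal_intros linear_mismatch)

lemmas linear_step_intros = linear_plant_step linear_zbar_step linear_observer_step

lemma tendsto_mismatch:
  "((\<lambda>w. mismatch P w v X i) \<longlongrightarrow> mismatch P w0 v X i) (nhds w0)"
  unfolding mismatch_def
proof (rule tendsto_net_diff)
  fix j
  show "((\<lambda>w. case j of None \<Rightarrow> - (Fmat P *v v) | Some k \<Rightarrow> Cbar P w k *v (X $ k)) \<longlongrightarrow>
      (case j of None \<Rightarrow> - (Fmat P *v v) | Some k \<Rightarrow> Cbar P w0 k *v (X $ k))) (nhds w0)"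
    by (cases j) (auto intro!: tendsto_matrix_vector tendsto_perturbed_matrices)
qed

lemma tendsto_steps:
  "((\<lambda>w. plant_step P w v X U) \<longlongrightarrow> plant_step P w0 v X U) (nhds w0)"
  "((\<lambda>w. zbar_step P G1 G2 w v X Z) \<longlongrightarrow> zbar_step P G1 G2 w0 v X Z) (nhds w0)"
  "((\<lambda>w. observer_step P L w v X U \<Xi>) \<longlongrightarrow> observer_step P L w0 v X U \<Xi>) (nhds w0)"
  unfolding plant_step_def zbar_step_def observer_step_def
  by (intro tendsto_vec_lambda tendsto_add tendsto_diff tendsto_matrix_vector tendsto_const
      tendsto_perturbed_matrices tendsto_mismatch)+

definition state_feedback_step where
  "state_feedback_step P G1 G2 Kx Kz w y = (let v = fst y; (X, Z) = fst (snd y); (Xr, Zr) = snd (snd y) in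
     (plant_step P w v X (\<lambda>i. Kx *v net_diff P (with_leader_0 Xr) i + Kz *v (Zr $ i)),
      zbar_step P G1 G2 w v X Z))"

definition output_feedback_step where
  "output_feedback_step P G1 G2 K1 K2 L w y =
     (let v = fst y; (X, Z, \<Xi>) = fst (snd y); (Xr, Zr, \<Xi>r) = snd (snd y);
          U = (\<lambda>i. K1 *v (Zr $ i) + K2 *v net_diff P (with_leader_0 \<Xi>r) i)
      in (plant_step P w v X U, zbar_step P G1 G2 w v X Z, observer_step P L w v X U \<Xi>))"

lemma state_feedback_linear_closed_loop:
  fixes P :: "('n::finite, 'm::finite, 'p::finite, 'q::finite, 'f::finite) mas"
    and G1 :: "real^'s^'s" and G2 :: "real^'p^'s" and Kx :: "real^'n^'m" and Kz :: "real^'s^'m"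
  shows "linear_closed_loop P (state_feedback_loop P G1 G2 Kx Kz) (state_feedback_step P G1 G2 Kx Kz)"
proof (rule linear_closed_loop.intro)
  show "linear (state_feedback_step P G1 G2 Kx Kz w)" for w
    unfolding state_feedback_step_def Let_def case_prod_beta
    by (intro linear_Pair linear_step_intros linear_signal_intros)
next
  fix y
  show "((\<lambda>w. state_feedback_step P G1 G2 Kx Kz w y) \<longlongrightarrow> state_feedback_step P G1 G2 Kx Kz 0 y) (nhds 0)"
    unfolding state_feedback_step_def Let_def case_prod_beta
    by (intro tendsto_Pair tendsto_steps)
next
  fix w v x c
  show "state_feedback_loop P G1 G2 Kx Kz w v x c \<longleftrightarrow> (\<forall>t\<ge>0. (x (t + 1), c (t + 1)) =
      state_feedback_step P G1 G2 Kx Kz w (v t, (x t, c t),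
        (x (t - int (rcom P + rcon P)), c (t - int (rcom P + rcon P)))))"
    by (auto simp: Let_def state_feedback_loop_def plant_eqs_def zbar_eqs_def state_feedback_def eta_def
        state_feedback_step_def plant_step_def zbar_step_def virtual_error_mismatch vec_eq_iff[of "x _"]
        vec_eq_iff[of "c _"] algebra_simps)
qed

lemma output_feedback_linear_closed_loop:
  fixes P :: "('n::finite, 'm::finite, 'p::finite, 'q::finite, 'f::finite) mas"
    and G1 :: "real^'s^'s" and G2 :: "real^'p^'s"
    and K1 :: "real^'s^'m" and K2 :: "real^'n^'m" and L :: "real^'p^'n"
  shows "linear_closed_loop P (output_feedback_loop P G1 G2 K1 K2 L) (output_feedback_step P G1 G2 K1 K2 L)"
proof (rule linear_closed_loop.intro)
  show "linear (output_feedback_step P G1 G2 K1 K2 L w)" for w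
    unfolding output_feedback_step_def Let_def case_prod_beta
    by (intro linear_Pair linear_step_intros linear_signal_intros)
next
  fix y
  show "((\<lambda>w. output_feedback_step P G1 G2 K1 K2 L w y) \<longlongrightarrow> output_feedback_step P G1 G2 K1 K2 L 0 y) (nhds 0)"
    unfolding output_feedback_step_def Let_def case_prod_beta
    by (intro tendsto_Pair tendsto_steps)
next
  fix w v x and c :: "int \<Rightarrow> ((real^'s)^'f) \<times> ((real^'n)^'f)"
  have "c = (\<lambda>t. (fst (c t), snd (c t)))" by simp
  then obtain zb \<xi> where c: "c = (\<lambda>t. (zb t, \<xi> t))" by metis
  show "output_feedback_loop P G1 G2 K1 K2 L w v x c \<longleftrightarrow> (\<forall>t\<ge>0. (x (t + 1), c (t + 1)) =
      output_feedback_step P G1 G2 K1 K2 L w (v t, (x t, c t),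
        (x (t - int (rcom P + rcon P)), c (t - int (rcom P + rcon P)))))"
    unfolding c
    by (auto simp: output_feedback_loop_def plant_eqs_def zbar_eqs_def observer_eqs_def
        output_feedback_def etabar_def Let_def
        output_feedback_step_def plant_step_def zbar_step_def observer_step_def
        virtual_error_mismatch vec_eq_iff[of "x _"]
        vec_eq_iff[of "zb _"] vec_eq_iff[of "\<xi> _"] algebra_simps)
qed

section \<open>Comparison with the auxiliary augmented system\<close>

text \<open>
  The delayed signal \<open>z t = zb (t - rcom)\<close> satisfies the internal model equation of the auxiliary
  system only from time \<open>rcom\<close> on, since that of \<open>zb\<close> holds from time 0 on. Advancing everything by
  \<open>rcom\<close> cures this: \<open>z\<close> becomes \<open>zb\<close> itself, and the other signals are advanced.
\<close>

lemma state_feedback_loop_delayed: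
  assumes "state_feedback_loop P G1 G2 Kx Kz w v x zb"
  shows "aux_state_feedback_loop P G1 G2 Kx Kz w (\<lambda>t. v (t + int (rcom P)))
    (\<lambda>t. x (t + int (rcom P))) zb"
proof -
  have x: "x (t + int (rcom P) + 1) $ i = Abar P w i *v (x (t + int (rcom P)) $ i)
      + Bbar P w i *v state_feedback P Kx Kz x zb i (t + int (rcom P) - int (rcon P))
      + Ebar P w i *v v (t + int (rcom P))" if "t \<ge> 0" for t i
    using assms that by (simp add: state_feedback_loop_def plant_eqs_def)
  show ?thesis
    using assms x
    by (simp add: aux_state_feedback_loop_def state_feedback_loop_def plant_eqs_def aux_z_eqs_def zbar_eqs_def
        state_feedback_def zbar_of_def eta_def virtual_error_mismatch algebra_simps)
qed

text \<open>
  The observer is driven by the undelayed virtual error, so its state is advanced together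
  with the plant state.
\<close>

lemma output_feedback_loop_delayed:
  assumes "output_feedback_loop P G1 G2 K1 K2 L w v x (\<lambda>t. (zb t, \<xi> t))"
  shows "aux_output_feedback_loop P G1 G2 K1 K2 L w (\<lambda>t. v (t + int (rcom P)))
    (\<lambda>t. x (t + int (rcom P))) (\<lambda>t. (zb t, \<xi> (t + int (rcom P))))"
proof -
  let ?u = "output_feedback P K1 K2 zb \<xi>"
  have x: "x (t + int (rcom P) + 1) $ i = Abar P w i *v (x (t + int (rcom P)) $ i)
      + Bbar P w i *v ?u i (t + int (rcom P) - int (rcon P))
      + Ebar P w i *v v (t + int (rcom P))"
    and \<xi>: "\<xi> (t + int (rcom P) + 1) $ i = Anom P *v (\<xi> (t + int (rcom P)) $ i)
      + Bnom P *v ?u i (t + int (rcom P) - int (rcon P))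
      - (L ** Cnom P) *v etabar P \<xi> i (t + int (rcom P))
      + L *v virtual_error P w v x i (t + int (rcom P))" if "t \<ge> 0" for t i
    using assms that by (simp_all add: output_feedback_loop_def Let_def plant_eqs_def observer_eqs_def)
  show ?thesis
    using assms x \<xi>
    by (simp add: aux_output_feedback_loop_def output_feedback_loop_def plant_eqs_def aux_z_eqs_def zbar_eqs_def
        observer_eqs_def Let_def
        output_feedback_def zbar_of_def etabar_def virtual_error_mismatch algebra_simps)
qed

text \<open>
  The following estimates are those required for the simulation of a loop by its auxiliary loop,
  each prime standing for an advance by \<open>rcom\<close>: the plant state (and the observer state) is
  advanced, the internal model state is not.
\<close>

lemma norm_advance_component:
  fixes a a' a'' :: "'a::real_normed_vector" and z z' :: "'b::real_normed_vector"
  shows "norm (a', z) \<le> 2 * (norm (a', z') + norm (a, z))"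
    and "norm (a', z') \<le> 2 * (norm (a', z) + norm (a'', z'))"
proof -
  note parts = norm_fst_le[of a' z'] norm_snd_le[of z a] norm_fst_le[of a' z] norm_snd_le[of z' a'']
  have "norm (a', z) \<le> norm a' + norm z" "norm (a', z') \<le> norm a' + norm z'"
    by (rule norm_Pair_le)+
  moreover have "0 \<le> norm (a', z')" "0 \<le> norm (a, z)" "0 \<le> norm (a', z)" "0 \<le> norm (a'', z')" by simp_all
  ultimately show "norm (a', z) \<le> 2 * (norm (a', z') + norm (a, z))"
    and "norm (a', z') \<le> 2 * (norm (a', z) + norm (a'', z'))"
    using parts by (simp_all only: distrib_left)
qed

lemma norm_advance_outer_components:
  fixes a a' a'' :: "'a::real_normed_vector" and z z' :: "'b::real_normed_vector"
    and d d' d'' :: "'d::real_normed_vector"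
  shows "norm (a', z, d') \<le> 2 * (norm (a', z', d') + norm (a, z, d))"
    and "norm (a', z', d') \<le> 2 * (norm (a', z, d') + norm (a'', z', d''))"
proof -
  have sum: "norm (a, z, d) \<le> norm a + norm z + norm d"
    and parts: "norm a \<le> norm (a, z, d)" "norm z \<le> norm (a, z, d)" "norm d \<le> norm (a, z, d)"
    for a :: 'a and z :: 'b and d :: 'd
    using norm_Pair_le[of a "(z, d)"] norm_Pair_le[of z d] norm_fst_le[of a "(z, d)"]
      norm_snd_le[of "(z, d)" a] norm_fst_le[of z d] norm_snd_le[of d z] by linarith+
  show "norm (a', z, d') \<le> 2 * (norm (a', z', d') + norm (a, z, d))"
    using sum[of a' z d'] parts(1)[of a' z' d'] parts(3)[of d' a' z'] parts(2)[of z a d] norm_ge_zero[of z] by argo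
  show "norm (a', z', d') \<le> 2 * (norm (a', z, d') + norm (a'', z', d''))"
    using sum[of a' z' d'] parts(1)[of a' z d'] parts(3)[of d' a' z] parts(2)[of z' a'' d''] norm_ge_zero[of z'] by argo
qed

theorem lemma3p1:
  fixes P :: "('n::finite, 'm::finite, 'p::finite, 'q::finite, 'f::finite) mas"
    and G1 :: "real^('p \<times> 'k::finite)^('p \<times> 'k)"
    and G2 :: "real^'p^('p \<times> 'k)"
  assumes "weighted_digraph P"
    and "\<not> (\<exists>\<mu>. is_eigenvalue (Smat P) \<mu> \<and> cmod \<mu> < 1)"
    and "digraph_connected P"
    and "minimal_p_copy_internal_model (Smat P) G1 G2"
  shows "(\<forall>(Kx :: real^'n^'m) (Kz :: real^('p \<times> 'k)^'m).
            nominal_exp_stable P (aux_state_feedback_loop P G1 G2 Kx Kz) \<longrightarrow>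
            solves_coop_robust_output_regulation P (state_feedback_loop P G1 G2 Kx Kz)) \<and>
         (\<forall>(K1 :: real^('p \<times> 'k)^'m) (K2 :: real^'n^'m) (L :: real^'p^'n).
            nominal_exp_stable P (aux_output_feedback_loop P G1 G2 K1 K2 L) \<longrightarrow>
            solves_coop_robust_output_regulation P (output_feedback_loop P G1 G2 K1 K2 L))"
proof (intro conjI allI impI)
  fix Kx :: "real^'n^'m" and Kz :: "real^('p \<times> 'k)^'m"
  assume aux: "nominal_exp_stable P (aux_state_feedback_loop P G1 G2 Kx Kz)"
  interpret linear_closed_loop P "state_feedback_loop P G1 G2 Kx Kz" "state_feedback_step P G1 G2 Kx Kz"
    by (rule state_feedback_linear_closed_loop)
  have stable: "nominal_exp_stable P (state_feedback_loop P G1 G2 Kx Kz)"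
  proof (rule nominal_exp_stable_of_auxiliary[OF aux, where m = "rcom P"])
    fix x zb assume "state_feedback_loop P G1 G2 Kx Kz 0 (\<lambda>_. 0) x zb"
    then have "aux_state_feedback_loop P G1 G2 Kx Kz 0 (\<lambda>_. 0) (\<lambda>t. x (t + int (rcom P))) zb"
      by (rule state_feedback_loop_delayed)
    then show "\<exists>x' z'. aux_state_feedback_loop P G1 G2 Kx Kz 0 (\<lambda>_. 0) x' z' \<and>
        (\<forall>t. norm (x' t, z' t) \<le> 2 * (norm (x (t + int (rcom P)), zb (t + int (rcom P))) + norm (x t, zb t)) \<and>
             norm (x (t + int (rcom P)), zb (t + int (rcom P)))
               \<le> 2 * (norm (x' t, z' t) + norm (x' (t + int (rcom P)), z' (t + int (rcom P)))))"
      by (intro exI conjI allI) (assumption | rule norm_advance_component)+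
  qed
  show "solves_coop_robust_output_regulation P (state_feedback_loop P G1 G2 Kx Kz)"
    by (rule regulation_by_internal_model[OF assms(1,3,4) linear_ident _ stable])
      (simp add: state_feedback_loop_def)
next
  fix K1 :: "real^('p \<times> 'k)^'m" and K2 :: "real^'n^'m" and L :: "real^'p^'n"
  assume aux: "nominal_exp_stable P (aux_output_feedback_loop P G1 G2 K1 K2 L)"
  interpret linear_closed_loop P "output_feedback_loop P G1 G2 K1 K2 L" "output_feedback_step P G1 G2 K1 K2 L"
    by (rule output_feedback_linear_closed_loop)
  have stable: "nominal_exp_stable P (output_feedback_loop P G1 G2 K1 K2 L)"
  proof (rule nominal_exp_stable_of_auxiliary[OF aux, where m = "rcom P"])
    fix x and c :: "int \<Rightarrow> ((real^('p \<times> 'k))^'f) \<times> ((real^'n)^'f)"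
    assume loop: "output_feedback_loop P G1 G2 K1 K2 L 0 (\<lambda>_. 0) x c"
    let ?m = "int (rcom P)"
    define x' where "x' t = x (t + ?m)" for t
    define c' where "c' t = (fst (c t), snd (c (t + ?m)))" for t
    have "aux_output_feedback_loop P G1 G2 K1 K2 L 0 (\<lambda>_. 0) x' c'"
      using output_feedback_loop_delayed[of P G1 G2 K1 K2 L 0 "\<lambda>_. 0" x "\<lambda>t. fst (c t)" "\<lambda>t. snd (c t)"] loop
      by (simp add: x'_def[abs_def] c'_def[abs_def])
    moreover have "norm (x' t, c' t) \<le> 2 * (norm (x (t + ?m), c (t + ?m)) + norm (x t, c t))"
      and "norm (x (t + ?m), c (t + ?m)) \<le> 2 * (norm (x' t, c' t) + norm (x' (t + ?m), c' (t + ?m)))" for t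
    proof -
      obtain b d b' d' b'' d'' where "c t = (b, d)" "c (t + ?m) = (b', d')" "c (t + ?m + ?m) = (b'', d'')"
        by (meson surj_pair)
      then show "norm (x' t, c' t) \<le> 2 * (norm (x (t + ?m), c (t + ?m)) + norm (x t, c t))"
        and "norm (x (t + ?m), c (t + ?m)) \<le> 2 * (norm (x' t, c' t) + norm (x' (t + ?m), c' (t + ?m)))"
        by (simp_all only: x'_def c'_def fst_conv snd_conv norm_advance_outer_components)
    qed
    ultimately show "\<exists>x' c'. aux_output_feedback_loop P G1 G2 K1 K2 L 0 (\<lambda>_. 0) x' c' \<and>
        (\<forall>t. norm (x' t, c' t) \<le> 2 * (norm (x (t + ?m), c (t + ?m)) + norm (x t, c t)) \<and>
             norm (x (t + ?m), c (t + ?m)) \<le> 2 * (norm (x' t, c' t) + norm (x' (t + ?m), c' (t + ?m))))"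
      by blast
  qed
  show "solves_coop_robust_output_regulation P (output_feedback_loop P G1 G2 K1 K2 L)"
    by (rule regulation_by_internal_model[OF assms(1,3,4) linear_fst _ stable])
      (simp add: output_feedback_loop_def Let_def)
qed

end
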